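(* Let $d\ge1$, $s\in(0,1)$, $0<\lambda\le\Lambda$ and $M\ge0$. There exists $\delta>0$, depending only on $d,s,\lambda,\Lambda,M$, with the following property. Let $R>0$, let $K:\mathbb{R}^d\to\mathbb{R}$ be a measurable kernel satisfying $\lambda|y|^{-d-s}\le K(y)\le\Lambda|y|^{-d-s}$ and $K(y)=K(-y)$ for all $y\ne0$, and let $E\subset\mathbb{R}^d$ be a Borel set with $0\in\partial E$. Suppose that $H_{K,E}\le MR^{-s}$ in $B_{R/2}$ in the viscosity sense and that $|E\cap B_R|<\delta|B_R|$. Then the set \[ \{x\in\partial E\cap B_{R/4}:\ H_{K,E}(x)=+\infty\} \] has positive Lebesgue measure. Here $H_{K,E}(x)=+\infty$ means the defining limit exists and equals $+\infty$.
   Context: $B_\rho(x)$ is the open ball of radius $\rho$ centred at $x$, $B_\rho=B_\rho(0)$, and $|F|$ denotes Lebesgue measure. Sets are not identified up to null sets, and $\partial E$ is the topological boundary. Put $\tilde\chi_E=\chi_{\mathbb{R}^d\setminus E}-\chi_E$. The nonlocal mean curvature of $E$ at $x\in\partial E$ is \[ H_{K,E}(x)=\lim_{\varepsilon\to0^+}\int_{\mathbb{R}^d\setminus B_\varepsilon(x)}\tilde\chi_E(y)K(x-y)\,dy, \] whenever the limit exists (possibly $+\infty$). It exists in $(-\infty,+\infty]$ at boundary points admitting an exterior touching ball. "$H_{K,E}\le C_0$ in an open set $\Omega$ in the viscosity sense" means the following. Take any $x\in\partial E\cap\Omega$ for which there is an open ball $B\subset\mathbb{R}^d\setminus E$ with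 $x\in\partial B$. At every such $x$ one has $H_{K,E}(x)\le C_0$. *)

theory Defs
  imports "HOL-Analysis.Analysis"
begin

definition tchi :: "'a set \<Rightarrow> 'a \<Rightarrow> real" where
  "tchi E y = (if y \<in> E then -1 else 1)"

definition nmc_trunc :: "('a::euclidean_space \<Rightarrow> real) \<Rightarrow> 'a set \<Rightarrow> 'a \<Rightarrow> real \<Rightarrow> real" where
  "nmc_trunc K E x e = (LINT y : (UNIV - ball x e) | lebesgue. tchi E y * K (x - y))"

text \<open>Nonlocal mean curvature H_{K,E}(x), as an extended real: the limit as eps -> 0+
  (meaningful whenever the limit exists in the extended reals).\<close>
definition nmc :: "('a::euclidean_space \<Rightarrow> real) \<Rightarrow> 'a set \<Rightarrow> 'a \<Rightarrow> ereal" where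
  "nmc K E x = Lim (at_right 0) (\<lambda>e. ereal (nmc_trunc K E x e))"

definition exterior_touching_ball :: "'a::euclidean_space set \<Rightarrow> 'a \<Rightarrow> bool" where
  "exterior_touching_ball E x \<longleftrightarrow> (\<exists>c r. r > 0 \<and> ball c r \<subseteq> UNIV - E \<and> x \<in> frontier (ball c r))"

definition nmc_le_visc :: "('a::euclidean_space \<Rightarrow> real) \<Rightarrow> 'a set \<Rightarrow> 'a set \<Rightarrow> real \<Rightarrow> bool" where
  "nmc_le_visc K E \<Omega> C0 \<longleftrightarrow>
     (\<forall>x \<in> frontier E \<inter> \<Omega>. exterior_touching_ball E x \<longrightarrow> nmc K E x \<le> ereal C0)"

end

theory Submission
  imports Defs
begin

text \<open>
  By Lebesgue's density theorem, almost every point of \<open>\<partial>E\<close> outside \<open>E\<close> has curvature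
  \<open>+\<infinity>\<close> and almost every point inside \<open>E\<close> has curvature \<open>-\<infinity>\<close>; so up to a null set the set in
  question is the part of \<open>closure E - E\<close> in \<open>B\<^bsub>R/4\<^esub>\<close>. Suppose this is null. As
  \<open>E\<close> has small measure in \<open>B\<^bsub>R\<^esub>\<close>, the maximal inequality provides a point \<open>z\<close> near \<open>0\<close>, outside
  \<open>closure E\<close>, around which \<open>E\<close> has small density at every scale up to \<open>R/4\<close>. Let \<open>x\<close> be a
  nearest point of \<open>closure E\<close> and \<open>r = |x - z| \<le> R/16\<close>. The ball \<open>B\<^bsub>r\<^esub>(z)\<close> touches \<open>E\<close> from outside at
  \<open>x\<close>, which controls the curvature integral from below at scales under \<open>\<theta>r\<close>, while
  the small density makes the larger scales contribute at least a multiple of \<open>(\<theta>r)\<^bsup>-s\<^esup>\<close>. For small \<open>\<theta>\<close>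
  the curvature at \<open>x\<close> exceeds \<open>M R\<^bsup>-s\<^esup>\<close>, contradicting the viscosity bound.
\<close>

subsection \<open>Lebesgue density\<close>

lemma measure_lebesgue_ball:
  fixes x :: "'a::euclidean_space"
  assumes "0 \<le> t"
  shows "measure lebesgue (ball x t) = unit_ball_vol (real DIM('a)) * t ^ DIM('a)"
  using content_ball[OF assms, of x] by (simp add: measure_completion)

lemma lmeasurable_Int_ball: "A \<in> sets lebesgue \<Longrightarrow> A \<inter> ball x t \<in> lmeasurable"
  by (metis Int_commute fmeasurable_Int_fmeasurable lmeasurable_ball)

text \<open>Weak-type maximal bound by Vitali covering: disjoint dense balls are selected whose
  fivefold enlargements cover the bad set, and each selected ball has volume below
  \<open>1 / \<kappa>\<close> times the measure of \<open>U\<close> inside it. The cap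
  \<open>T\<close> supplies the bounded radii that the covering lemma asks for, and the measurable
  hull \<open>V\<close> stands in for the bad set itself.\<close>

lemma maximal_inequality_ball:
  fixes U :: "'a::euclidean_space set"
  assumes U: "U \<in> lmeasurable" and \<kappa>: "\<kappa> > 0"
  obtains V where "V \<in> lmeasurable" "measure lebesgue V \<le> 5 ^ DIM('a) / \<kappa> * measure lebesgue U"
    "{x. \<exists>t. 0 < t \<and> t \<le> T \<and> \<kappa> * measure lebesgue (ball x t) < measure lebesgue (U \<inter> ball x t)} \<subseteq> V"
proof -
  define A where "A = {x. \<exists>t. 0 < t \<and> t \<le> T \<and> \<kappa> * measure lebesgue (ball x t) < measure lebesgue (U \<inter> ball x t)}"
  have "\<exists>r. \<forall>x\<in>A. 0 < r x \<and> r x \<le> T \<and> \<kappa> * measure lebesgue (ball x (r x)) < measure lebesgue (U \<inter> ball x (r x))"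
    by (intro bchoice) (auto simp: A_def)
  then obtain r where r: "\<And>x. x \<in> A \<Longrightarrow> 0 < r x \<and> r x \<le> T"
    and dens: "\<And>x. x \<in> A \<Longrightarrow> \<kappa> * measure lebesgue (ball x (r x)) < measure lebesgue (U \<inter> ball x (r x))"
    by blast
  obtain C where C: "countable C" "C \<subseteq> A"
    and disj: "pairwise (\<lambda>i j. disjnt (cball i (r i)) (cball j (r j))) C"
    and cov: "\<And>i. i \<in> A \<Longrightarrow> \<exists>j. j \<in> C \<and> \<not> disjnt (cball i (r i)) (cball j (r j)) \<and>
                        cball i (r i) \<subseteq> ball j (5 * r j)"
    by (rule Vitali_covering_lemma_cballs_balls[of A r T "\<lambda>i. i", OF r]) blast+
  define V where "V = (\<Union>i\<in>C. ball i (5 * r i))"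
  \<comment> \<open>The bound is uniform over finite subfamilies; since \<open>C\<close> is
    countable, it passes to the full union together with measurability.\<close>
  have bound: "measure lebesgue (\<Union>i\<in>I. ball i (5 * r i)) \<le> 5 ^ DIM('a) / \<kappa> * measure lebesgue U"
    if I: "I \<subseteq> C" "finite I" for I
  proof -
    have "measure lebesgue (\<Union>i\<in>I. ball i (5 * r i)) \<le> (\<Sum>i\<in>I. measure lebesgue (ball i (5 * r i)))"
      using I by (intro measure_UNION_le) auto
    also have "\<dots> \<le> (\<Sum>i\<in>I. 5 ^ DIM('a) / \<kappa> * measure lebesgue (U \<inter> ball i (r i)))"
    proof (rule sum_mono)
      fix i assume "i \<in> I"
      then have i: "i \<in> A" using I C by auto
      have "measure lebesgue (ball i (5 * r i)) = 5 ^ DIM('a) * measure lebesgue (ball i (r i))"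
        using r[OF i] by (simp add: content_ball power_mult_distrib)
      also have "\<dots> \<le> 5 ^ DIM('a) * (measure lebesgue (U \<inter> ball i (r i)) / \<kappa>)"
        using dens[OF i] \<kappa> by (intro mult_left_mono) (auto simp: field_simps)
      finally show "measure lebesgue (ball i (5 * r i)) \<le> 5 ^ DIM('a) / \<kappa> * measure lebesgue (U \<inter> ball i (r i))"
        by simp
    qed
    also have "\<dots> = 5 ^ DIM('a) / \<kappa> * (\<Sum>i\<in>I. measure lebesgue (U \<inter> ball i (r i)))"
      by (simp add: sum_distrib_left)
    also have "(\<Sum>i\<in>I. measure lebesgue (U \<inter> ball i (r i))) = measure lebesgue (\<Union>i\<in>I. U \<inter> ball i (r i))"
    proof (rule measure_UNION'[symmetric])
      show "pairwise (\<lambda>i j. disjnt (U \<inter> ball i (r i)) (U \<inter> ball j (r j))) I"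
        by (rule pairwise_mono[OF disj _ I(1)]) (meson Int_lower2 ball_subset_cball disjnt_subset1 disjnt_subset2 order_trans)
    qed (use U I in \<open>auto intro: lmeasurable_Int_ball\<close>)
    also have "\<dots> \<le> measure lebesgue U"
      using U I fmeasurableD[OF lmeasurable_Int_ball]
      by (intro measure_mono_fmeasurable sets.finite_UN) auto
    finally show ?thesis
      using \<kappa> by (simp add: mult_left_mono divide_right_mono)
  qed
  show thesis
  proof
    show "V \<in> lmeasurable" "measure lebesgue V \<le> 5 ^ DIM('a) / \<kappa> * measure lebesgue U"
      unfolding V_def using fmeasurable_UN_bound[OF C(1) lmeasurable_ball bound]
        measure_UN_bound[OF C(1) lmeasurable_ball bound] by blast+
    show "{x. \<exists>t. 0 < t \<and> t \<le> T \<and> \<kappa> * measure lebesgue (ball x t) < measure lebesgue (U \<inter> ball x t)} \<subseteq> V"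
    proof -
      have "x \<in> V" if "x \<in> A" for x
        using cov[OF that] r[OF that] unfolding V_def by fastforce
      then show ?thesis unfolding A_def by blast
    qed
  qed
qed

definition null_density :: "'a::euclidean_space set \<Rightarrow> 'a \<Rightarrow> bool" where
  "null_density E x \<longleftrightarrow> (\<forall>\<kappa>>0. \<exists>\<tau>>0. \<forall>t. 0 < t \<and> t \<le> \<tau> \<longrightarrow>
     measure lebesgue (E \<inter> ball x t) \<le> \<kappa> * measure lebesgue (ball x t))"

text \<open>A closed \<open>C\<close> inside \<open>E \<inter> ball 0 \<rho>\<close> leaves a
  remainder of tiny measure. A point of the bad set lies off \<open>C\<close>, so small balls around
  it miss \<open>C\<close> and meet \<open>E\<close> only in the remainder; the maximal inequality
  for the remainder then bounds the bad set.\<close>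

lemma negligible_positive_upper_density_ball:
  fixes E :: "'a::euclidean_space set"
  assumes E: "E \<in> sets lebesgue" and \<kappa>: "\<kappa> > 0"
  shows "negligible {x \<in> ball 0 \<rho>. x \<notin> E \<and> (\<forall>\<tau>>0. \<exists>t. 0 < t \<and> t \<le> \<tau> \<and>
     \<kappa> * measure lebesgue (ball x t) < measure lebesgue (E \<inter> ball x t))}" (is "negligible ?A")
  unfolding negligible_outer_le
proof (intro allI impI)
  fix e :: real assume "e > 0"
  \<comment> \<open>Calibrated to cancel the factor \<open>5 ^ DIM('a) / \<kappa>\<close> of the
    maximal inequality.\<close>
  define e' where "e' = e * \<kappa> / 5 ^ DIM('a)"
  have "e' > 0" using \<open>e > 0\<close> \<kappa> by (simp add: e'_def)
  obtain C where C: "closed C" "C \<subseteq> E \<inter> ball 0 \<rho>" "E \<inter> ball 0 \<rho> - C \<in> lmeasurable"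
      "emeasure lebesgue (E \<inter> ball 0 \<rho> - C) < ennreal e'"
    using sets_lebesgue_inner_closed[OF fmeasurableD[OF lmeasurable_Int_ball[OF E]] \<open>e' > 0\<close>] by blast
  then have m: "measure lebesgue (E \<inter> ball 0 \<rho> - C) \<le> e'"
    using \<open>e' > 0\<close> by (simp add: emeasure_eq_measure2 ennreal_less_iff)
  obtain V where V: "V \<in> lmeasurable" "measure lebesgue V \<le> 5 ^ DIM('a) / \<kappa> * measure lebesgue (E \<inter> ball 0 \<rho> - C)"
    "{x. \<exists>t. 0 < t \<and> t \<le> 1 \<and> \<kappa> * measure lebesgue (ball x t) < measure lebesgue ((E \<inter> ball 0 \<rho> - C) \<inter> ball x t)} \<subseteq> V"
    by (rule maximal_inequality_ball[OF C(3) \<kappa>])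
  have "?A \<subseteq> V"
  proof
    fix x assume x: "x \<in> ?A"
    then have "x \<in> ball 0 \<rho> - C" "open (ball 0 \<rho> - C)" using C by auto
    then obtain \<tau> where \<tau>: "\<tau> > 0" "ball x \<tau> \<subseteq> ball 0 \<rho> - C"
      using openE by blast
    obtain t where t: "0 < t" "t \<le> min \<tau> 1" "\<kappa> * measure lebesgue (ball x t) < measure lebesgue (E \<inter> ball x t)"
      using x \<tau>(1) by (auto dest!: spec[of _ "min \<tau> 1"])
    have "ball x t \<subseteq> ball x \<tau>" using t by (intro subset_ball) simp
    then have "(E \<inter> ball 0 \<rho> - C) \<inter> ball x t = E \<inter> ball x t"
      using \<tau> by blast
    then have "0 < t \<and> t \<le> 1 \<and> \<kappa> * measure lebesgue (ball x t) < measure lebesgue ((E \<inter> ball 0 \<rho> - C) \<inter> ball x t)"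
      using t by simp
    then show "x \<in> V" using V(3) by blast
  qed
  moreover have "5 ^ DIM('a) / \<kappa> * measure lebesgue (E \<inter> ball 0 \<rho> - C) \<le> 5 ^ DIM('a) / \<kappa> * e'"
    using m \<kappa> by (intro mult_left_mono) auto
  moreover have "5 ^ DIM('a) / \<kappa> * e' = e" using \<kappa> by (simp add: e'_def)
  ultimately show "\<exists>T. ?A \<subseteq> T \<and> T \<in> lmeasurable \<and> measure lebesgue T \<le> e"
    using V by (intro exI[of _ V]) auto
qed

text \<open>Countably many radii \<open>n\<close> and thresholds 1/(k+1) exhaust the exceptional
  points. Applied to \<open>- E\<close>, the lemma also says that almost every point of
  \<open>E\<close> is a point of full density.\<close>

lemma negligible_not_null_density:
  fixes E :: "'a::euclidean_space set"
  assumes E: "E \<in> sets lebesgue"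
  shows "negligible {x. x \<notin> E \<and> \<not> null_density E x}"
proof -
  define A where "A n k = {x \<in> ball 0 (real n). x \<notin> E \<and> (\<forall>\<tau>>0. \<exists>t. 0 < t \<and> t \<le> \<tau> \<and>
     inverse (real (Suc k)) * measure lebesgue (ball x t) < measure lebesgue (E \<inter> ball x t))}" for n k
  have "{x. x \<notin> E \<and> \<not> null_density E x} \<subseteq> (\<Union>n k. A n k)"
  proof
    fix x assume x: "x \<in> {x. x \<notin> E \<and> \<not> null_density E x}"
    then obtain \<kappa> where \<kappa>: "\<kappa> > 0" "\<forall>\<tau>>0. \<exists>t. 0 < t \<and> t \<le> \<tau> \<and>
       \<kappa> * measure lebesgue (ball x t) < measure lebesgue (E \<inter> ball x t)"
      unfolding null_density_def by (auto simp: not_le)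
    obtain n where n: "norm x < real n" using reals_Archimedean2 by blast
    obtain k where k: "inverse (real (Suc k)) < \<kappa>" using reals_Archimedean[OF \<kappa>(1)] by blast
    have "inverse (real (Suc k)) * measure lebesgue (ball x t) \<le> \<kappa> * measure lebesgue (ball x t)" for t
      using k by (intro mult_right_mono) auto
    then have "x \<in> A n k" using x n \<kappa>(2) unfolding A_def
      by (fastforce dest: le_less_trans)
    then show "x \<in> (\<Union>n k. A n k)" by blast
  qed
  moreover have "negligible (A n k)" for n k
    unfolding A_def by (rule negligible_positive_upper_density_ball[OF E]) simp
  ultimately show ?thesis
    by (meson negligible_subset negligible_countable_Union negligible_Union_nat)
qed

subsection \<open>Thin slabs\<close>

text \<open>A packing argument: about t/h translates of the slab piece along \<open>e\<close> are
  disjoint and fit into a ball of radius \<open>4 * t\<close>, so each has at most the corresponding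
  share of its volume.\<close>

lemma measure_slab_le:
  fixes e :: "'a::euclidean_space"
  assumes e: "norm e = 1" and h: "0 < h" "2 * h \<le> t"
  shows "measure lebesgue {u \<in> ball 0 t. \<bar>u \<bullet> e\<bar> \<le> h} \<le> 2 * h / t * (unit_ball_vol (real DIM('a)) * (4 * t) ^ DIM('a))"
proof -
  define S where "S = {u \<in> ball 0 t. \<bar>u \<bullet> e\<bar> \<le> h}"
  define n where "n = nat \<lfloor>t / h\<rfloor>"
  have S: "S \<in> lmeasurable"
  proof -
    have "{u. \<bar>u \<bullet> e\<bar> \<le> h} \<in> sets borel" by measurable
    then have "{u. \<bar>u \<bullet> e\<bar> \<le> h} \<inter> ball 0 t \<in> lmeasurable"
      by (intro lmeasurable_Int_ball) auto
    then show ?thesis unfolding S_def by (simp add: Int_def conj_commute)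
  qed
  have tpos: "t > 0" using h by simp
  have n: "real n \<le> t / h" "t / h - 1 \<le> real n"
    unfolding n_def using h tpos by auto
  \<comment> \<open>Rounding down loses at most 1, and t/h is at least 2, so t/h - 1 is still at
    least half of t/h.\<close>
  have n2: "t / (2 * h) \<le> real n"
  proof -
    have "1 \<le> t / (2 * h)" using h by simp
    then have "t / (2*h) \<le> t / h - 1" using h by (simp add: field_simps)
    then show ?thesis using n by simp
  qed
  \<comment> \<open>The spacing \<open>3 * h\<close> exceeds the thickness \<open>2 * h\<close> of
    the slab, which makes the translates disjoint; the shifts are at most \<open>3 * t\<close>,
    whence the radius \<open>4 * t\<close>.\<close>
  define X where "X k = (+) ((3 * h * real k) *\<^sub>R e) ` S" for k :: nat
  have ee: "e \<bullet> e = 1" using e by (simp add: norm_eq_1)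
  have X: "X k \<in> lmeasurable" "measure lebesgue (X k) = measure lebesgue S" for k
    unfolding X_def using S by (auto intro: measurable_translation measure_translation)
  have "real n * measure lebesgue S = (\<Sum>k<n. measure lebesgue (X k))"
    by (simp add: X)
  also have "\<dots> = measure lebesgue (\<Union>k<n. X k)"
  proof (rule measure_UNION'[symmetric])
    show "pairwise (\<lambda>i j. disjnt (X i) (X j)) {..<n}"
    proof -
      have False if ij: "i \<noteq> j" and u: "u \<in> X i" "u \<in> X j" for i j u
      proof -
        have "\<bar>u \<bullet> e - 3 * h * real k\<bar> \<le> h" if "u \<in> X k" for k
          using that ee by (auto simp: X_def S_def inner_add_left)
        from this[OF u(1)] this[OF u(2)] have "\<bar>3 * h * real i - 3 * h * real j\<bar> \<le> 2 * h" by linarith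
        moreover have "\<bar>3 * h * real i - 3 * h * real j\<bar> = h * (3 * \<bar>real i - real j\<bar>)"
          using h by (simp add: abs_mult mult.assoc flip: right_diff_distrib)
        ultimately have "h * (3 * \<bar>real i - real j\<bar>) \<le> h * 2"
          by simp
        then have "3 * \<bar>real i - real j\<bar> \<le> 2" using h by simp
        moreover have "1 \<le> \<bar>real i - real j\<bar>" using ij by (cases i j rule: linorder_cases) auto
        ultimately show False by simp
      qed
      then show ?thesis by (auto simp: pairwise_def disjnt_def)
    qed
  qed (use X in auto)
  also have "\<dots> \<le> measure lebesgue (ball (0::'a) (4 * t))"
  proof (rule measure_mono_fmeasurable)
    show "(\<Union>k<n. X k) \<subseteq> ball 0 (4 * t)"
    proof
      fix u assume "u \<in> (\<Union>k<n. X k)"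
      then obtain k v where k: "k < n" "v \<in> S" "u = (3 * h * real k) *\<^sub>R e + v"
        unfolding X_def by auto
      have "norm u \<le> 3 * h * real k + norm v"
        using k(3) norm_triangle_ineq[of "(3 * h * real k) *\<^sub>R e" v] e h by simp
      moreover have "h * real k \<le> t"
      proof -
        have "real k \<le> t / h" using k n by linarith
        then show ?thesis using h by (simp add: field_simps)
      qed
      moreover have "norm v < t" using k by (simp add: S_def)
      ultimately show "u \<in> ball 0 (4 * t)" by simp
    qed
  qed (use X in auto)
  also have "\<dots> = unit_ball_vol (real DIM('a)) * (4 * t) ^ DIM('a)"
    using tpos by (intro measure_lebesgue_ball) simp
  finally have "real n * measure lebesgue S \<le> unit_ball_vol (real DIM('a)) * (4 * t) ^ DIM('a)" .
  moreover have "t / (2 * h) * measure lebesgue S \<le> real n * measure lebesgue S"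
    using n2 by (intro mult_right_mono) auto
  ultimately have "t / (2 * h) * measure lebesgue S \<le> unit_ball_vol (real DIM('a)) * (4 * t) ^ DIM('a)"
    by linarith
  then show ?thesis using h tpos unfolding S_def[symmetric] by (simp add: field_simps)
qed

text \<open>Expanding |z - u| >= |z| and |z + u| >= |z| gives 2 |u . z| <= |u|^2, so the region lies
  in a slab of half-width \<open>t\<^sup>2 / (2 * r)\<close> orthogonal to \<open>z\<close>. The
  resulting extra power of \<open>t\<close> is what tames the kernel at the origin.\<close>

lemma measure_outside_tangent_balls_le:
  fixes z :: "'a::euclidean_space"
  assumes r: "norm z = r" "r > 0" and t: "0 < t" "t \<le> r"
  shows "measure lebesgue ({u. u \<notin> ball z r \<and> - u \<notin> ball z r} \<inter> ball 0 t)
    \<le> 4 ^ DIM('a) * unit_ball_vol (real DIM('a)) / r * t ^ (DIM('a) + 1)"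
proof -
  define e where "e = z /\<^sub>R r"
  define h where "h = t\<^sup>2 / (2 * r)"
  have e: "norm e = 1" using r by (simp add: e_def)
  have h: "0 < h" "2 * h \<le> t"
    using r t by (auto simp: h_def field_simps power2_eq_square)
  have sub: "{u. u \<notin> ball z r \<and> - u \<notin> ball z r} \<inter> ball 0 t \<subseteq> {u \<in> ball 0 t. \<bar>u \<bullet> e\<bar> \<le> h}"
  proof
    fix u assume u: "u \<in> {u. u \<notin> ball z r \<and> - u \<notin> ball z r} \<inter> ball 0 t"
    have tu: "u \<bullet> u \<le> t\<^sup>2"
      using u t by (simp add: power2_norm_eq_inner[symmetric] power_mono)
    have "norm z \<le> norm (z - u)" "norm z \<le> norm (z + u)"
      using u r by (auto simp: dist_norm)
    then have "z \<bullet> z \<le> (z - u) \<bullet> (z - u)" "z \<bullet> z \<le> (z + u) \<bullet> (z + u)"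
      by (simp_all add: norm_le)
    then have "\<bar>u \<bullet> z\<bar> \<le> t\<^sup>2 / 2"
      using tu by (simp add: inner_diff_left inner_diff_right inner_add_left inner_add_right inner_commute)
    then have "\<bar>u \<bullet> e\<bar> \<le> h"
      using r by (simp add: e_def h_def field_simps abs_mult)
    then show "u \<in> {u \<in> ball 0 t. \<bar>u \<bullet> e\<bar> \<le> h}" using u by simp
  qed
  have meas: "{u. \<bar>u \<bullet> e\<bar> \<le> h} \<inter> ball 0 t \<in> lmeasurable"
  proof -
    have "{u. \<bar>u \<bullet> e\<bar> \<le> h} \<in> sets borel" by measurable
    then show ?thesis by (intro lmeasurable_Int_ball) auto
  qed
  have meas2: "{u. u \<notin> ball z r \<and> - u \<notin> ball z r} \<in> sets lebesgue"
  proof -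
    have "{u. u \<notin> ball z r \<and> - u \<notin> ball z r} \<in> sets borel"
      unfolding mem_ball by measurable
    then show ?thesis by auto
  qed
  have "measure lebesgue ({u. u \<notin> ball z r \<and> - u \<notin> ball z r} \<inter> ball 0 t)
      \<le> measure lebesgue {u \<in> ball 0 t. \<bar>u \<bullet> e\<bar> \<le> h}"
    using sub meas meas2 by (intro measure_mono_fmeasurable) (auto simp: Int_def conj_commute)
  also have "\<dots> \<le> 2 * h / t * (unit_ball_vol (real DIM('a)) * (4 * t) ^ DIM('a))"
    by (rule measure_slab_le[OF e h])
  also have "\<dots> = 4 ^ DIM('a) * unit_ball_vol (real DIM('a)) / r * t ^ (DIM('a) + 1)"
    using r t by (simp add: h_def field_simps power2_eq_square power_mult_distrib)
  finally show ?thesis .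
qed

subsection \<open>Integrals of the fractional kernel\<close>

definition frac_kernel :: "real \<Rightarrow> 'a::euclidean_space \<Rightarrow> real" where
  "frac_kernel s u = norm u powr (- (real DIM('a)) - s)"

lemma frac_kernel_nonneg: "0 \<le> frac_kernel s u"
  by (simp add: frac_kernel_def)

lemma borel_measurable_frac_kernel [measurable]: "frac_kernel s \<in> borel_measurable borel"
  unfolding frac_kernel_def by measurable

lemma frac_kernel_lebesgue_measurable: "frac_kernel s \<in> borel_measurable lebesgue"
  by (rule measurable_completion) simp

lemma frac_kernel_antimono:
  fixes u :: "'a::euclidean_space"
  assumes "0 < s" "0 < a" "a \<le> norm u"
  shows "frac_kernel s u \<le> a powr (- (real DIM('a)) - s)"
  unfolding frac_kernel_def using assms by (intro powr_mono2') auto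

text \<open>On \<open>A\<close>, \<open>f\<close> is majorised by the sum of the functions
  \<open>c k * indicator (B k)\<close>, where the sets may overlap. Working with the nonnegative
  integral gives integrability and the bound at once; the separate \<open>b\<close> lets a geometric
  series be supplied.\<close>

lemma set_integral_le_sums:
  fixes f :: "'a::euclidean_space \<Rightarrow> real"
  assumes A: "A \<in> sets lebesgue" and f: "f \<in> borel_measurable lebesgue" "\<And>u. 0 \<le> f u"
    and B: "\<And>k. B k \<in> lmeasurable" and c: "\<And>k. 0 \<le> c k"
    and cover: "\<And>u. u \<in> A \<Longrightarrow> \<exists>k::nat. u \<in> B k \<and> f u \<le> c k"
    and b: "\<And>k. c k * measure lebesgue (B k) \<le> b k" "b sums L"
  shows "set_integrable lebesgue A f" and "(LINT u:A|lebesgue. f u) \<le> L"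
proof -
  have b0: "0 \<le> b k" for k
    using b(1)[of k] c[of k] by (meson measure_nonneg mult_nonneg_nonneg order_trans)
  have L0: "0 \<le> L" using b0 b(2) by (metis sums_le sums_zero)
  have meas: "(\<lambda>u. indicator A u * f u) \<in> borel_measurable lebesgue"
    using A f by measurable
  have "(\<integral>\<^sup>+u. ennreal (indicator A u * f u) \<partial>lebesgue)
      \<le> (\<integral>\<^sup>+u. (\<Sum>k. ennreal (c k) * indicator (B k) u) \<partial>lebesgue)"
  proof (rule nn_integral_mono)
    fix u
    show "ennreal (indicator A u * f u) \<le> (\<Sum>k. ennreal (c k) * indicator (B k) u)"
    proof (cases "u \<in> A")
      case True
      then obtain k where k: "u \<in> B k" "f u \<le> c k" using cover by blast
      have "ennreal (indicator A u * f u) \<le> (\<Sum>i\<in>{k}. ennreal (c i) * indicator (B i) u)"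
        using True k by (simp add: ennreal_leI)
      also have "\<dots> \<le> (\<Sum>k. ennreal (c k) * indicator (B k) u)"
        by (rule sum_le_suminf) auto
      finally show ?thesis .
    qed simp
  qed
  also have "\<dots> = (\<Sum>k. \<integral>\<^sup>+u. ennreal (c k) * indicator (B k) u \<partial>lebesgue)"
    using B by (intro nn_integral_suminf) (auto intro!: borel_measurable_times_ennreal borel_measurable_indicator)
  also have "\<dots> = (\<Sum>k. ennreal (c k) * emeasure lebesgue (B k))"
    by (intro arg_cong[where f=suminf] ext nn_integral_cmult_indicator fmeasurableD B)
  also have "\<dots> \<le> (\<Sum>k. ennreal (b k))"
  proof (rule suminf_le)
    fix k
    have "ennreal (c k) * emeasure lebesgue (B k) = ennreal (c k * measure lebesgue (B k))"
      unfolding emeasure_eq_measure2[OF B] using c by (simp add: ennreal_mult)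
    also have "\<dots> \<le> ennreal (b k)" using b by (intro ennreal_leI) auto
    finally show "ennreal (c k) * emeasure lebesgue (B k) \<le> ennreal (b k)" .
  qed auto
  also have "\<dots> = ennreal L"
    using b0 b(2) by (simp add: suminf_ennreal2 sums_iff)
  finally have le: "(\<integral>\<^sup>+u. ennreal (indicator A u * f u) \<partial>lebesgue) \<le> ennreal L" .
  have int: "integrable lebesgue (\<lambda>u. indicator A u * f u)"
  proof (rule integrableI_nonneg[OF meas])
    show "(\<integral>\<^sup>+u. ennreal (indicator A u * f u) \<partial>lebesgue) < \<infinity>"
      using le by (rule le_less_trans) simp
  qed (simp add: f)
  then show "set_integrable lebesgue A f" by (simp add: set_integrable_def)
  have "ennreal (integral\<^sup>L lebesgue (\<lambda>u. indicator A u * f u)) \<le> ennreal L"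
    using le nn_integral_eq_integral[OF int] f by simp
  then show "(LINT u:A|lebesgue. f u) \<le> L"
    using L0 by (simp add: set_lebesgue_integral_def)
qed

text \<open>This lemma and the next differ in which end is strict. In both uses the strict end puts
  \<open>u\<close> into the open ball of the shell, and the other end bounds the kernel.\<close>

lemma dyadic_ge:
  fixes x :: real
  assumes "1 \<le> x"
  shows "\<exists>k. 2 ^ k \<le> x \<and> x < 2 ^ Suc k"
proof -
  obtain n where "x < 2 ^ n" using real_arch_pow[of 2 x] by auto
  then have "\<exists>k<n. (\<forall>i\<le>k. \<not> x < 2 ^ i) \<and> x < 2 ^ Suc k"
    using assms by (intro ex_least_nat_less) auto
  then show ?thesis by (auto simp: not_less)
qed

lemma dyadic_gt:
  fixes x :: real
  assumes "1 < x"
  shows "\<exists>k. 2 ^ k < x \<and> x \<le> 2 ^ Suc k"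
proof -
  obtain n where "x < 2 ^ n" using real_arch_pow[of 2 x] by auto
  then have "\<exists>k<n. (\<forall>i\<le>k. \<not> x \<le> 2 ^ i) \<and> x \<le> 2 ^ Suc k"
    using assms by (intro ex_least_nat_less) auto
  then show ?thesis by (auto simp: not_le)
qed

text \<open>Sum of a geometric series with ratio \<open>2 powr (- s)\<close>. The factor
  \<open>2 ^ d\<close> arises because a dyadic shell is measured by its outer ball while the kernel
  is bounded at its inner radius.\<close>

definition outer_const :: "nat \<Rightarrow> real \<Rightarrow> real" where
  "outer_const d s = 2 ^ d / (1 - 2 powr (- s))"

text \<open>Here the ratio is \<open>2 powr (s - 1)\<close>, and the series starts at exponent 1
  because shell \<open>k\<close> has inner radius \<open>\<rho> / 2 ^ Suc k\<close>.\<close>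

definition inner_const :: "nat \<Rightarrow> real \<Rightarrow> real" where
  "inner_const d s = 2 ^ (d + 1) * (2 powr (s - 1) / (1 - 2 powr (s - 1)))"

lemma outer_const_pos: "0 < s \<Longrightarrow> 0 < outer_const d s"
  by (simp add: outer_const_def powr_less_one)

lemma inner_const_pos: "s < 1 \<Longrightarrow> 0 < inner_const d s"
  by (simp add: inner_const_def powr_less_one)

text \<open>On the shell between 2^k \<sigma> and 2^(k+1) \<sigma> the kernel is at most (2^k
  \<sigma>)^(-d-s) and the measure at most m (2^(k+1) \<sigma>)^d, so the contributions decay like
  2^(-sk).\<close>

lemma frac_kernel_outer:
  fixes A :: "'a::euclidean_space set"
  assumes A: "A \<in> sets lebesgue" and s: "0 < s" and \<sigma>: "0 < \<sigma>" and m: "0 \<le> m"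
    and growth: "\<And>t. \<sigma> \<le> t \<Longrightarrow> measure lebesgue (A \<inter> ball 0 t) \<le> m * t ^ DIM('a)"
  shows "set_integrable lebesgue (A - ball 0 \<sigma>) (frac_kernel s)"
    and "(LINT u:A - ball 0 \<sigma>|lebesgue. frac_kernel s u) \<le> outer_const DIM('a) s * m * \<sigma> powr (- s)"
proof -
  define c where "c k = (2 ^ k * \<sigma>) powr (- (real DIM('a)) - s)" for k :: nat
  define B where "B k = A \<inter> ball 0 (2 ^ Suc k * \<sigma>)" for k :: nat
  define b where "b k = (2 ^ DIM('a) * m * \<sigma> powr (- s)) * (2 powr (- s)) ^ k" for k :: nat
  have cover: "\<exists>k. u \<in> B k \<and> frac_kernel s u \<le> c k" if "u \<in> A - ball 0 \<sigma>" for u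
  proof -
    have "1 \<le> norm u / \<sigma>" using that \<sigma> by simp
    then obtain k where k: "2 ^ k \<le> norm u / \<sigma>" "norm u / \<sigma> < 2 ^ Suc k"
      using dyadic_ge by blast
    then have "2 ^ k * \<sigma> \<le> norm u" "norm u < 2 ^ Suc k * \<sigma>"
      using \<sigma> by (simp_all add: field_simps)
    then show ?thesis using that s \<sigma>
      by (intro exI[of _ k]) (auto simp: B_def c_def intro!: frac_kernel_antimono)
  qed
  have bb: "c k * measure lebesgue (B k) \<le> b k" for k
  proof -
    have p: "2 ^ k * \<sigma> > 0" using \<sigma> by simp
    have "\<sigma> \<le> 2 ^ Suc k * \<sigma>"
      using \<sigma> one_le_power[of "2::real" "Suc k"] by (simp del: power_Suc)
    then have "c k * measure lebesgue (B k) \<le> c k * (m * (2 ^ Suc k * \<sigma>) ^ DIM('a))"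
      unfolding B_def by (intro mult_left_mono growth) (auto simp: c_def)
    also have "\<dots> = 2 ^ DIM('a) * m * (c k * (2 ^ k * \<sigma>) powr (real DIM('a)))"
      using p by (simp add: powr_realpow power_mult_distrib)
    also have "c k * (2 ^ k * \<sigma>) powr (real DIM('a)) = (2 ^ k * \<sigma>) powr (- s)"
      unfolding c_def by (simp flip: powr_add)
    also have "\<dots> = (2 powr (- s)) ^ k * \<sigma> powr (- s)"
      using \<sigma> by (simp add: powr_mult powr_powr mult.commute flip: powr_realpow)
    finally show ?thesis by (simp add: b_def mult_ac)
  qed
  have "b sums (2 ^ DIM('a) * m * \<sigma> powr (- s) * (1 / (1 - 2 powr (- s))))"
    unfolding b_def using s by (intro sums_mult geometric_sums) (simp add: powr_less_one)
  then have sums: "b sums (outer_const DIM('a) s * m * \<sigma> powr (- s))"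
    by (simp add: outer_const_def mult_ac)
  have 1: "A - ball 0 \<sigma> \<in> sets lebesgue" using A by auto
  have 2: "B k \<in> lmeasurable" for k unfolding B_def by (rule lmeasurable_Int_ball[OF A])
  have 3: "0 \<le> c k" for k by (simp add: c_def)
  show "set_integrable lebesgue (A - ball 0 \<sigma>) (frac_kernel s)"
    "(LINT u:A - ball 0 \<sigma>|lebesgue. frac_kernel s u) \<le> outer_const DIM('a) s * m * \<sigma> powr (- s)"
    by (rule set_integral_le_sums[OF 1 frac_kernel_lebesgue_measurable frac_kernel_nonneg 2 3 cover bb sums]; assumption)+
qed

text \<open>The shells now shrink towards 0. Growth of order d+1 beats the singularity of order d+s
  because s < 1, leaving contributions of order 2^(-(1-s)k).\<close>

lemma frac_kernel_inner:
  fixes A :: "'a::euclidean_space set"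
  assumes A: "A \<in> sets lebesgue" and s: "0 < s" "s < 1" and \<rho>: "0 < \<rho>" and m: "0 \<le> m"
    and growth: "\<And>t. 0 < t \<Longrightarrow> t \<le> \<rho> \<Longrightarrow> measure lebesgue (A \<inter> ball 0 t) \<le> m * t ^ (DIM('a) + 1)"
  shows "set_integrable lebesgue (A \<inter> ball 0 \<rho>) (frac_kernel s)"
    and "(LINT u:A \<inter> ball 0 \<rho>|lebesgue. frac_kernel s u) \<le> inner_const DIM('a) s * m * \<rho> powr (1 - s)"
proof -
  define c where "c k = (\<rho> / 2 ^ Suc k) powr (- (real DIM('a)) - s)" for k :: nat
  define B where "B k = A \<inter> ball 0 (\<rho> / 2 ^ k)" for k :: nat
  define b where "b k = (2 ^ (DIM('a) + 1) * m * \<rho> powr (1 - s) * 2 powr (s - 1)) * (2 powr (s - 1)) ^ k" for k :: nat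
  have cover: "\<exists>k. u \<in> B k \<and> frac_kernel s u \<le> c k" if "u \<in> A \<inter> ball 0 \<rho>" for u
  proof (cases "u = 0")
    \<comment> \<open>\<open>powr\<close> with base 0 is 0, so the kernel vanishes at the origin and
      index 0 serves.\<close>
    case True
    then show ?thesis using that \<rho> by (intro exI[of _ 0]) (auto simp: B_def c_def frac_kernel_def)
  next
    case False
    have "1 < \<rho> / norm u" using that False by simp
    then obtain k where k: "2 ^ k < \<rho> / norm u" "\<rho> / norm u \<le> 2 ^ Suc k"
      using dyadic_gt by blast
    then have "norm u < \<rho> / 2 ^ k" "\<rho> / 2 ^ Suc k \<le> norm u"
      using False by (simp_all add: field_simps)
    then show ?thesis using that s \<rho>
      by (intro exI[of _ k]) (auto simp: B_def c_def intro!: frac_kernel_antimono)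
  qed
  have bb: "c k * measure lebesgue (B k) \<le> b k" for k
  proof -
    define x where "x = \<rho> / 2 ^ Suc k"
    have x: "x > 0" "\<rho> / 2 ^ k = 2 * x" using \<rho> by (simp_all add: x_def)
    have "\<rho> / 2 ^ k \<le> \<rho> / 1" using \<rho> by (intro divide_left_mono) auto
    then have "2 * x \<le> \<rho>" using x(2) by simp
    then have "c k * measure lebesgue (B k) \<le> c k * (m * (2 * x) ^ (DIM('a) + 1))"
      unfolding B_def x(2) using x by (intro mult_left_mono growth) (auto simp: c_def)
    also have "\<dots> = 2 ^ (DIM('a) + 1) * m * (c k * x powr (real (DIM('a) + 1)))"
      using x by (subst powr_realpow) (auto simp: power_mult_distrib)
    also have "c k * x powr (real (DIM('a) + 1)) = x powr (1 - s)"
      unfolding c_def x_def[symmetric] by (simp flip: powr_add)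
    also have "\<dots> = \<rho> powr (1 - s) * (2 powr (s - 1)) ^ Suc k"
    proof -
      have "x = \<rho> * 2 powr (- real (Suc k))" 
        by (simp add: x_def powr_minus powr_realpow divide_inverse del: of_nat_Suc power_Suc)
      then have "x powr (1 - s) = \<rho> powr (1 - s) * 2 powr ((s - 1) * real (Suc k))"
        using \<rho> by (simp add: powr_mult powr_powr algebra_simps)
      also have "2 powr ((s - 1) * real (Suc k)) = (2 powr (s - 1)) ^ Suc k"
        by (simp add: powr_powr flip: powr_realpow del: power_Suc of_nat_Suc)
      finally show ?thesis .
    qed
    finally show ?thesis by (simp add: b_def mult_ac)
  qed
  have "b sums (2 ^ (DIM('a) + 1) * m * \<rho> powr (1 - s) * 2 powr (s - 1) * (1 / (1 - 2 powr (s - 1))))"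
    unfolding b_def using s by (intro sums_mult geometric_sums) (simp add: powr_less_one)
  then have sums: "b sums (inner_const DIM('a) s * m * \<rho> powr (1 - s))"
    by (simp add: inner_const_def mult_ac)
  have 1: "A \<inter> ball 0 \<rho> \<in> sets lebesgue" using A by auto
  have 2: "B k \<in> lmeasurable" for k unfolding B_def by (rule lmeasurable_Int_ball[OF A])
  have 3: "0 \<le> c k" for k by (simp add: c_def)
  show "set_integrable lebesgue (A \<inter> ball 0 \<rho>) (frac_kernel s)"
    "(LINT u:A \<inter> ball 0 \<rho>|lebesgue. frac_kernel s u) \<le> inner_const DIM('a) s * m * \<rho> powr (1 - s)"
    by (rule set_integral_le_sums[OF 1 frac_kernel_lebesgue_measurable frac_kernel_nonneg 2 3 cover bb sums]; assumption)+
qed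

lemma frac_kernel_outside_ball:
  fixes \<sigma> s :: real
  assumes s: "0 < s" and \<sigma>: "0 < \<sigma>"
  shows "set_integrable lebesgue (- ball (0::'a::euclidean_space) \<sigma>) (frac_kernel s)"
    and "(LINT u:- ball (0::'a) \<sigma>|lebesgue. frac_kernel s u)
      \<le> outer_const DIM('a) s * unit_ball_vol (real DIM('a)) * \<sigma> powr (- s)"
  using frac_kernel_outer[of "UNIV :: 'a set" s \<sigma> "unit_ball_vol (real DIM('a))"] s \<sigma>
  by (simp_all add: content_ball Compl_eq_Diff_UNIV)

text \<open>The kernel is bounded below by its value at radius \<open>2 * \<sigma>\<close>, and the
  shell has at least the volume of the inner ball because 2^d - 1 >= 1. This shell supplies the
  positive part of the curvature.\<close>

lemma frac_kernel_shell_ge: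
  fixes \<sigma> s :: real
  assumes s: "0 < s" and \<sigma>: "0 < \<sigma>"
  shows "2 powr (- (real DIM('a)) - s) * unit_ball_vol (real DIM('a)) * \<sigma> powr (- s)
    \<le> (LINT u:ball (0::'a::euclidean_space) (2 * \<sigma>) - ball 0 \<sigma>|lebesgue. frac_kernel s u)"
proof -
  let ?S = "ball (0::'a) (2 * \<sigma>) - ball 0 \<sigma>"
  let ?c = "(2 * \<sigma>) powr (- (real DIM('a)) - s)"
  have S: "?S \<in> lmeasurable" by (intro fmeasurable.Diff) auto
  have sub: "ball (0::'a) \<sigma> \<subseteq> ball 0 (2 * \<sigma>)" using \<sigma> by (intro subset_ball) simp
  have "measure lebesgue ?S = measure lebesgue (ball (0::'a) (2 * \<sigma>)) - measure lebesgue (ball (0::'a) \<sigma>)"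
    using sub by (intro measurable_measure_Diff) auto
  also have "\<dots> = unit_ball_vol (real DIM('a)) * \<sigma> ^ DIM('a) * (2 ^ DIM('a) - 1)"
    using \<sigma> by (simp add: content_ball power_mult_distrib algebra_simps)
  also have "\<dots> \<ge> unit_ball_vol (real DIM('a)) * \<sigma> ^ DIM('a) * 1"
  proof (rule mult_left_mono)
    have "(2::real) ^ 1 \<le> 2 ^ DIM('a)" by (intro power_increasing) (auto simp: Suc_leI)
    then show "1 \<le> (2::real) ^ DIM('a) - 1" by simp
  qed (use \<sigma> in simp)
  finally have mS: "unit_ball_vol (real DIM('a)) * \<sigma> ^ DIM('a) \<le> measure lebesgue ?S" by simp
  have "2 powr (- (real DIM('a)) - s) * unit_ball_vol (real DIM('a)) * \<sigma> powr (- s)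
      = ?c * (unit_ball_vol (real DIM('a)) * \<sigma> ^ DIM('a))"
  proof -
    have "\<sigma> powr (- s) = \<sigma> powr (- (real DIM('a)) - s) * \<sigma> ^ DIM('a)"
      using \<sigma> by (simp flip: powr_realpow powr_add)
    then show ?thesis using \<sigma> by (simp add: powr_mult)
  qed
  also have "\<dots> \<le> ?c * measure lebesgue ?S"
    using mS by (intro mult_left_mono) auto
  also have "\<dots> = (LINT u:?S|lebesgue. ?c)"
    using S by (simp add: set_lebesgue_integral_def fmeasurableD)
  also have "\<dots> \<le> (LINT u:?S|lebesgue. frac_kernel s u)"
  proof (rule set_integral_mono)
    show "set_integrable lebesgue ?S (\<lambda>u. ?c)"
      using S unfolding set_integrable_def by (auto simp: fmeasurable_def)
    show "set_integrable lebesgue ?S (frac_kernel s)"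
      by (rule set_integrable_subset[OF frac_kernel_outside_ball(1)[OF s \<sigma>]]) auto
    show "?c \<le> frac_kernel s u" if "u \<in> ?S" for u
      unfolding frac_kernel_def using that s \<sigma> by (intro powr_mono2') auto
  qed
  finally show ?thesis .
qed

subsection \<open>Truncated curvature\<close>

text \<open>The reflection is the affine map scaling every coordinate by -1. It moves the
  singularity of the kernel to the origin.\<close>

lemma lebesgue_reflect:
  fixes x :: "'a::euclidean_space"
  shows measurable_lebesgue_reflect: "(\<lambda>y. x - y) \<in> lebesgue \<rightarrow>\<^sub>M lebesgue"
    and distr_lebesgue_reflect: "distr lebesgue lebesgue (\<lambda>y. x - y) = lebesgue"
proof -
  have eq: "(\<lambda>y::'a. x + (\<Sum>j\<in>Basis. ((-1) * (y \<bullet> j)) *\<^sub>R j)) = (\<lambda>y. x - y)"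
    by (simp add: sum_negf euclidean_representation)
  show "(\<lambda>y. x - y) \<in> lebesgue \<rightarrow>\<^sub>M lebesgue"
    using lebesgue_affine_measurable[of "\<lambda>_. -1" x] unfolding eq by simp
  show "distr lebesgue lebesgue (\<lambda>y. x - y) = lebesgue"
    using lebesgue_affine_euclidean[of "\<lambda>_. -1" x] unfolding eq by (simp add: density_1)
qed

lemma integral_lebesgue_reflect:
  fixes f :: "'a::euclidean_space \<Rightarrow> real"
  assumes "f \<in> borel_measurable lebesgue"
  shows "(LINT y|lebesgue. f (x - y)) = integral\<^sup>L lebesgue f"
  using integral_distr[OF measurable_lebesgue_reflect assms, of x]
  by (simp add: distr_lebesgue_reflect)

lemma reflect_measurable:
  fixes E :: "'a::euclidean_space set"
  assumes "E \<in> sets lebesgue"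
  shows "{u. x - u \<in> E} \<in> sets lebesgue"
  using measurable_sets[OF measurable_lebesgue_reflect assms, of x] by (simp add: vimage_def)

lemma measure_reflect_Int_ball:
  fixes E :: "'a::euclidean_space set"
  assumes "E \<in> sets lebesgue"
  shows "measure lebesgue ({u. x - u \<in> E} \<inter> ball 0 t) = measure lebesgue (E \<inter> ball x t)"
proof -
  have "measure lebesgue (E \<inter> ball x t) = measure (distr lebesgue lebesgue (\<lambda>y. x - y)) (E \<inter> ball x t)"
    by (simp only: distr_lebesgue_reflect)
  also have "\<dots> = measure lebesgue ((\<lambda>y. x - y) -` (E \<inter> ball x t) \<inter> space lebesgue)"
    using assms by (intro measure_distr measurable_lebesgue_reflect) auto
  also have "(\<lambda>y. x - y) -` (E \<inter> ball x t) \<inter> space lebesgue = {u. x - u \<in> E} \<inter> ball 0 t"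
    by (auto simp: dist_norm)
  finally show ?thesis by simp
qed

lemma borel_measurable_tchi:
  assumes "E \<in> sets M"
  shows "tchi E \<in> borel_measurable M"
proof -
  have "tchi E = (\<lambda>y. 1 - 2 * indicator E y)"
    by (auto simp: tchi_def indicator_def)
  then show ?thesis using assms by simp
qed

lemma abs_tchi: "\<bar>tchi E y\<bar> = 1"
  by (simp add: tchi_def)

text \<open>The limit is the supremum of \<open>f \<sigma> - \<eta> \<sigma>\<close>: the hypothesis
  bounds \<open>f\<close> from below near 0 by each of these values, and
  \<open>f \<epsilon> \<le> l + \<eta> \<epsilon>\<close> bounds it from above when the supremum is
  finite.\<close>

lemma tendsto_ereal_almost_antimono:
  fixes f \<eta> :: "real \<Rightarrow> real"
  assumes r: "r > 0" and f: "\<And>\<epsilon> \<sigma>. 0 < \<epsilon> \<Longrightarrow> \<epsilon> \<le> \<sigma> \<Longrightarrow> \<sigma> \<le> r \<Longrightarrow> f \<sigma> - \<eta> \<sigma> \<le> f \<epsilon>"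
    and \<eta>: "(\<eta> \<longlongrightarrow> 0) (at_right 0)"
  obtains l where "((\<lambda>\<epsilon>. ereal (f \<epsilon>)) \<longlongrightarrow> l) (at_right 0)"
proof -
  define l where "l = (SUP \<sigma>\<in>{0<..r}. ereal (f \<sigma> - \<eta> \<sigma>))"
  have le: "ereal (f \<sigma> - \<eta> \<sigma>) \<le> l" if "0 < \<sigma>" "\<sigma> \<le> r" for \<sigma>
    unfolding l_def using that by (intro SUP_upper) auto
  have near: "eventually (\<lambda>\<epsilon>. 0 < \<epsilon> \<and> \<epsilon> < b) (at_right 0)" if "b > 0" for b :: real
    using that by (rule eventually_at_rightI[of 0 b, rotated]) simp
  have "((\<lambda>\<epsilon>. ereal (f \<epsilon>)) \<longlongrightarrow> l) (at_right 0)"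
  proof (rule order_tendstoI)
    fix a assume "a < l"
    then obtain \<sigma> where \<sigma>: "0 < \<sigma>" "\<sigma> \<le> r" "a < ereal (f \<sigma> - \<eta> \<sigma>)"
      unfolding l_def less_SUP_iff by auto
    show "eventually (\<lambda>\<epsilon>. a < ereal (f \<epsilon>)) (at_right 0)"
      using near[OF \<sigma>(1)]
    proof eventually_elim
      case (elim \<epsilon>)
      then have "f \<sigma> - \<eta> \<sigma> \<le> f \<epsilon>" using \<sigma> by (intro f) auto
      then show ?case using \<sigma>(3) by (meson ereal_less_eq(3) less_le_trans)
    qed
  next
    fix a assume a: "l < a"
    have "l \<noteq> -\<infinity>" using le[OF r order_refl] by auto
    moreover have "l \<noteq> \<infinity>" using a by auto
    ultimately obtain l' where l': "l = ereal l'" by (cases l) auto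
    obtain b where b: "l' < b" "ereal b < a"
      using ereal_dense2[OF a] unfolding l' by auto
    have "eventually (\<lambda>\<epsilon>. \<eta> \<epsilon> < b - l') (at_right 0)"
      using \<eta> b by (intro order_tendstoD(2)) auto
    then show "eventually (\<lambda>\<epsilon>. ereal (f \<epsilon>) < a) (at_right 0)"
      using near[OF r]
    proof eventually_elim
      case (elim \<epsilon>)
      then have "f \<epsilon> - \<eta> \<epsilon> \<le> l'" using le[of \<epsilon>] unfolding l' by simp
      then have "ereal (f \<epsilon>) < ereal b" using elim by simp
      then show ?case using b(2) by (rule less_trans)
    qed
  qed
  then show thesis by (rule that)
qed

section \<open>Truncated integrals for a kernel comparable to the fractional one\<close>

locale elliptic_kernel =
  fixes K :: "'a::euclidean_space \<Rightarrow> real" and s lam Lam :: real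
  assumes s: "0 < s" "s < 1" and lam: "0 < lam" "lam \<le> Lam"
    and K_measurable: "K \<in> borel_measurable lebesgue"
    and K_lower: "\<And>y. y \<noteq> 0 \<Longrightarrow> lam * frac_kernel s y \<le> K y"
    and K_upper: "\<And>y. y \<noteq> 0 \<Longrightarrow> K y \<le> Lam * frac_kernel s y"
    and K_even: "\<And>y. y \<noteq> 0 \<Longrightarrow> K (- y) = K y"
begin

definition integrand :: "'a set \<Rightarrow> real \<Rightarrow> 'a \<Rightarrow> real" where
  "integrand F \<epsilon> u = indicator (- ball 0 \<epsilon>) u * (tchi F u * K u)"

text \<open>The curvature integral at \<open>x\<close> in the variable \<open>u = x - y\<close>, with \<open>F = x - E\<close>.\<close>

definition trunc :: "'a set \<Rightarrow> real \<Rightarrow> real" where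
  "trunc F \<epsilon> = integral\<^sup>L lebesgue (integrand F \<epsilon>)"

lemma K_nonneg: "y \<noteq> 0 \<Longrightarrow> 0 \<le> K y"
  using K_lower[of y] lam frac_kernel_nonneg[of s y] by (meson less_imp_le mult_nonneg_nonneg order_trans)

lemma integrand_measurable:
  assumes "F \<in> sets lebesgue"
  shows "integrand F \<epsilon> \<in> borel_measurable lebesgue"
proof -
  have "indicator (- ball 0 \<epsilon>) \<in> (borel_measurable lebesgue :: ('a \<Rightarrow> real) set)"
    by (intro borel_measurable_indicator) auto
  then show ?thesis
    unfolding integrand_def using K_measurable borel_measurable_tchi[OF assms]
    by (intro borel_measurable_times) auto
qed

lemma integrable_integrand:
  assumes F: "F \<in> sets lebesgue" and \<epsilon>: "\<epsilon> > 0"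
  shows "integrable lebesgue (integrand F \<epsilon>)"
proof (rule Bochner_Integration.integrable_bound)
  show "integrable lebesgue (\<lambda>u::'a. Lam * (indicator (- ball 0 \<epsilon>) u *\<^sub>R frac_kernel s u))"
    using frac_kernel_outside_ball(1)[OF s(1) \<epsilon>] unfolding set_integrable_def
    by (rule integrable_mult_right)
  show "AE u in lebesgue. norm (integrand F \<epsilon> u) \<le> norm (Lam * (indicator (- ball 0 \<epsilon>) u *\<^sub>R frac_kernel s u))"
  proof (rule AE_I2)
    fix u :: 'a
    show "norm (integrand F \<epsilon> u) \<le> norm (Lam * (indicator (- ball 0 \<epsilon>) u *\<^sub>R frac_kernel s u))"
    proof (cases "u \<in> ball 0 \<epsilon>")
      case False
      then have "u \<noteq> 0" using \<epsilon> by auto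
      then show ?thesis using False K_upper[of u] K_nonneg[of u] lam frac_kernel_nonneg[of s u]
        by (simp add: integrand_def abs_mult abs_tchi)
    qed (simp add: integrand_def)
  qed
qed (rule integrand_measurable[OF F])

lemma nmc_trunc_eq_trunc:
  assumes E: "E \<in> sets lebesgue" and \<epsilon>: "\<epsilon> > 0"
  shows "nmc_trunc K E x \<epsilon> = trunc {u. x - u \<in> E} \<epsilon>"
proof -
  have "trunc {u. x - u \<in> E} \<epsilon> = (LINT y|lebesgue. integrand {u. x - u \<in> E} \<epsilon> (x - y))"
    unfolding trunc_def
    by (rule integral_lebesgue_reflect[symmetric]) (rule integrand_measurable[OF reflect_measurable[OF E]])
  also have "\<dots> = nmc_trunc K E x \<epsilon>"
    unfolding nmc_trunc_def set_lebesgue_integral_def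
    by (intro Bochner_Integration.integral_cong) (auto simp: integrand_def tchi_def indicator_def dist_norm norm_minus_commute)
  finally show ?thesis by simp
qed

lemma trunc_Compl:
  assumes "F \<in> sets lebesgue" "\<epsilon> > 0"
  shows "trunc (- F) \<epsilon> = - trunc F \<epsilon>"
proof -
  have "integrand (- F) \<epsilon> = (\<lambda>u. - integrand F \<epsilon> u)"
    by (auto simp: integrand_def tchi_def)
  then show ?thesis by (simp add: trunc_def)
qed

text \<open>The shell between \<sigma> and 2\<sigma> gives the gain. The losses come from
  \<open>F\<close> at radii between \<sigma> and \<tau>, where its density is at most of order
  \<kappa>, and from everything beyond \<tau>, where nothing is known about
  \<open>F\<close>.\<close>

lemma trunc_ge_of_small_density:
  assumes F: "F \<in> sets lebesgue" and \<sigma>: "0 < \<sigma>" "\<sigma> \<le> \<tau>" and \<kappa>: "0 \<le> \<kappa>"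
    and dens: "\<And>t. \<sigma> \<le> t \<Longrightarrow> t \<le> \<tau> \<Longrightarrow> measure lebesgue (F \<inter> ball 0 t) \<le> \<kappa> * t ^ DIM('a)"
  shows "(lam * (2 powr (- (real DIM('a)) - s) * unit_ball_vol (real DIM('a)))
       - 2 * Lam * outer_const DIM('a) s * \<kappa>) * \<sigma> powr (- s)
     - 2 * Lam * outer_const DIM('a) s * unit_ball_vol (real DIM('a)) * \<tau> powr (- s) \<le> trunc F \<sigma>"
proof -
  have \<tau>: "\<tau> > 0" using \<sigma> by simp
  let ?S = "ball (0::'a) (2 * \<sigma>) - ball 0 \<sigma>"
  let ?G = "F \<inter> ball 0 \<tau> - ball 0 \<sigma>"
  let ?w = "frac_kernel s :: 'a \<Rightarrow> real"
  have G: "F \<inter> ball 0 \<tau> \<in> sets lebesgue" using F by auto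
  \<comment> \<open>The tail estimate needs growth at all scales from \<sigma> on. Beyond \<tau> the
    measure of the cut-off set stays constant while t^d increases.\<close>
  have growth: "measure lebesgue (F \<inter> ball 0 \<tau> \<inter> ball 0 t) \<le> \<kappa> * t ^ DIM('a)" if t: "\<sigma> \<le> t" for t
  proof (cases "t \<le> \<tau>")
    case True
    have "F \<inter> ball 0 \<tau> \<inter> ball 0 t = F \<inter> ball 0 t" using subset_ball[OF True, of 0] by blast
    then show ?thesis using dens[OF t True] by simp
  next
    case False
    have "F \<inter> ball 0 \<tau> \<inter> ball 0 t = F \<inter> ball 0 \<tau>" using False subset_ball[of \<tau> t 0] by auto
    then have "measure lebesgue (F \<inter> ball 0 \<tau> \<inter> ball 0 t) \<le> \<kappa> * \<tau> ^ DIM('a)"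
      using dens[OF \<sigma>(2) order_refl] by simp
    also have "\<dots> \<le> \<kappa> * t ^ DIM('a)"
      using False \<tau> \<kappa> by (intro mult_left_mono power_mono) auto
    finally show ?thesis .
  qed
  note Gi = frac_kernel_outer[OF G s(1) \<sigma>(1) \<kappa> growth]
  note Ti = frac_kernel_outside_ball[OF s(1) \<tau>, where 'a='a]
  have Si: "set_integrable lebesgue ?S ?w"
    by (rule set_integrable_subset[OF frac_kernel_outside_ball(1)[OF s(1) \<sigma>(1)]]) auto
  have i1: "integrable lebesgue (\<lambda>u. indicator ?S u * ?w u)"
    and i2: "integrable lebesgue (\<lambda>u. indicator ?G u * ?w u)"
    and i3: "integrable lebesgue (\<lambda>u. indicator (- ball 0 \<tau>) u * ?w u)"
    using Si Gi(1) Ti(1) by (simp_all add: set_integrable_def)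
  \<comment> \<open>A pointwise minorant of the integrand. The factor 2 absorbs the shell term
    wherever the sign may be negative: \<open>lam - 2 * Lam \<le> - Lam\<close>.\<close>
  let ?g = "\<lambda>u. lam * (indicator ?S u * ?w u) - 2 * Lam * (indicator ?G u * ?w u)
     - 2 * Lam * (indicator (- ball 0 \<tau>) u * ?w u)"
  have "lam * (2 powr (- (real DIM('a)) - s) * unit_ball_vol (real DIM('a)) * \<sigma> powr (- s))
      \<le> lam * (LINT u:?S|lebesgue. ?w u)"
    using lam by (intro mult_left_mono frac_kernel_shell_ge s \<sigma>) auto
  moreover have "2 * Lam * (LINT u:?G|lebesgue. ?w u)
      \<le> 2 * Lam * (outer_const DIM('a) s * \<kappa> * \<sigma> powr (- s))"
    using lam by (intro mult_left_mono Gi(2)) auto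
  moreover have "2 * Lam * (LINT u:- ball 0 \<tau>|lebesgue. ?w u)
      \<le> 2 * Lam * (outer_const DIM('a) s * unit_ball_vol (real DIM('a)) * \<tau> powr (- s))"
    using lam by (intro mult_left_mono Ti(2)) auto
  moreover have "integral\<^sup>L lebesgue ?g = lam * (LINT u:?S|lebesgue. ?w u)
      - 2 * Lam * (LINT u:?G|lebesgue. ?w u) - 2 * Lam * (LINT u:- ball 0 \<tau>|lebesgue. ?w u)"
    using i1 i2 i3 by (simp add: set_lebesgue_integral_def)
  moreover have "integral\<^sup>L lebesgue ?g \<le> trunc F \<sigma>"
    unfolding trunc_def
  proof (rule integral_mono)
    show "integrable lebesgue ?g"
      using i1 i2 i3 by (intro Bochner_Integration.integrable_diff integrable_mult_right)
    show "integrable lebesgue (integrand F \<sigma>)" by (rule integrable_integrand[OF F \<sigma>(1)])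
    fix u :: 'a
    show "?g u \<le> integrand F \<sigma> u"
    proof (cases "u \<in> ball 0 \<sigma>")
      case True
      moreover have "u \<in> ball 0 \<tau>" using True \<sigma> by auto
      ultimately show ?thesis by (simp add: integrand_def)
    next
      case False
      then have u: "u \<noteq> 0" using \<sigma> by auto
      have w: "0 \<le> ?w u" by (rule frac_kernel_nonneg)
      have lw: "0 \<le> lam * ?w u" "lam * ?w u \<le> Lam * ?w u"
        using lam w by (auto intro: mult_right_mono)
      show ?thesis
        using False K_lower[OF u] K_upper[OF u] lw
        by (cases "u \<in> F"; cases "u \<in> ball 0 \<tau>"; cases "u \<in> ball 0 (2 * \<sigma>)")
          (simp_all add: integrand_def tchi_def)
    qed
  qed
  ultimately show ?thesis by (simp add: algebra_simps)
qed

text \<open>Reflection invariance of the measure and evenness of \<open>K\<close> permit pairing the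
  values at \<open>u\<close> and \<open>- u\<close>.\<close>

lemma trunc_symmetrized:
  assumes F: "F \<in> sets lebesgue" and \<epsilon>: "\<epsilon> > 0"
  shows "integrable lebesgue (\<lambda>u. integrand F \<epsilon> (- u))"
    and "trunc F \<epsilon> = integral\<^sup>L lebesgue (\<lambda>u. integrand F \<epsilon> (- u))"
proof -
  have eq: "(\<lambda>u. integrand F \<epsilon> (- u)) = integrand {u. 0 - u \<in> F} \<epsilon>"
  proof
    fix u :: 'a
    show "integrand F \<epsilon> (- u) = integrand {u. 0 - u \<in> F} \<epsilon> u"
      using \<epsilon> K_even[of u] by (cases "u = 0") (simp_all add: integrand_def tchi_def indicator_def)
  qed
  show "integrable lebesgue (\<lambda>u. integrand F \<epsilon> (- u))"
    unfolding eq by (rule integrable_integrand[OF reflect_measurable[OF F] \<epsilon>])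
  show "trunc F \<epsilon> = integral\<^sup>L lebesgue (\<lambda>u. integrand F \<epsilon> (- u))"
    unfolding trunc_def using integral_lebesgue_reflect[OF integrand_measurable[OF F], of \<epsilon> 0] by simp
qed

text \<open>The exterior ball and its reflection cancel in the principal value, which leaves
  only the thin region between them.\<close>

lemma trunc_touching_almost_antimono:
  assumes F: "F \<in> sets lebesgue" and z: "norm z = r" "r > 0" "F \<inter> ball z r = {}"
    and \<epsilon>: "0 < \<epsilon>" "\<epsilon> \<le> \<sigma>" "\<sigma> \<le> r"
  shows "trunc F \<sigma> - Lam * inner_const DIM('a) s * (4 ^ DIM('a) * unit_ball_vol (real DIM('a)) / r) * \<sigma> powr (1 - s)
     \<le> trunc F \<epsilon>"
proof -
  define P where "P = {u. u \<notin> ball z r \<and> - u \<notin> ball z r}"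
  have P: "P \<in> sets lebesgue"
  proof -
    have "P \<in> sets borel" unfolding P_def mem_ball by measurable
    then show ?thesis by auto
  qed
  have \<sigma>: "\<sigma> > 0" using \<epsilon> by simp
  let ?m = "4 ^ DIM('a) * unit_ball_vol (real DIM('a)) / r"
  let ?w = "frac_kernel s :: 'a \<Rightarrow> real"
  have growth: "measure lebesgue (P \<inter> ball 0 t) \<le> ?m * t ^ (DIM('a) + 1)" if "0 < t" "t \<le> \<sigma>" for t
    unfolding P_def using that \<epsilon> by (intro measure_outside_tangent_balls_le z) auto
  have m: "0 \<le> ?m" using z by simp
  note Pi = frac_kernel_inner[OF P s \<sigma> m growth]
  have iP: "integrable lebesgue (\<lambda>u. indicator (P \<inter> ball 0 \<sigma>) u * ?w u)"
    using Pi(1) by (simp add: set_integrable_def)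
  note i\<sigma> = integrable_integrand[OF F \<sigma>] trunc_symmetrized(1)[OF F \<sigma>]
  note i\<epsilon> = integrable_integrand[OF F \<epsilon>(1)] trunc_symmetrized(1)[OF F \<epsilon>(1)]
  let ?l = "\<lambda>u. integrand F \<sigma> u + integrand F \<sigma> (- u) - 2 * Lam * (indicator (P \<inter> ball 0 \<sigma>) u * ?w u)"
  let ?r = "\<lambda>u. integrand F \<epsilon> u + integrand F \<epsilon> (- u)"
  have "integral\<^sup>L lebesgue ?l \<le> integral\<^sup>L lebesgue ?r"
  proof (rule integral_mono)
    show "integrable lebesgue ?l"
      using i\<sigma> iP by (intro Bochner_Integration.integrable_diff Bochner_Integration.integrable_add integrable_mult_right)
    show "integrable lebesgue ?r"
      using i\<epsilon> by (intro Bochner_Integration.integrable_add)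
    fix u :: 'a
    have w: "0 \<le> Lam * ?w u" using lam frac_kernel_nonneg[of s u] by simp
    show "?l u \<le> ?r u"
    proof (cases "u \<in> ball 0 \<sigma> - ball 0 \<epsilon>")
      case True
      then have u: "u \<noteq> 0" using \<epsilon> by auto
      \<comment> \<open>Off \<open>P\<close> one of \<open>u\<close>, \<open>- u\<close> lies in the
        exterior ball, hence outside \<open>F\<close>, and the two signs add up to at least 0. On
        \<open>P\<close> the worst case is -2.\<close>
      have "- (if u \<in> P then Lam * ?w u else 0) * 2 \<le> (tchi F u + tchi F (- u)) * K u"
      proof (cases "u \<in> P")
        case True
        have "- 2 * K u \<le> (tchi F u + tchi F (- u)) * K u"
          using K_nonneg[OF u] by (intro mult_right_mono) (auto simp: tchi_def)
        then show ?thesis using True K_upper[OF u] by simp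
      next
        case False
        then have "u \<notin> F \<or> - u \<notin> F" using z by (auto simp: P_def)
        then have "0 \<le> (tchi F u + tchi F (- u)) * K u"
          using K_nonneg[OF u] by (intro mult_nonneg_nonneg) (auto simp: tchi_def)
        then show ?thesis using False by simp
      qed
      then show ?thesis using True K_even[OF u]
        by (simp add: integrand_def algebra_simps indicator_def split: if_splits)
    next
      case False
      then consider "u \<in> ball 0 \<epsilon>" "u \<in> ball 0 \<sigma>" | "u \<notin> ball 0 \<sigma>" "u \<notin> ball 0 \<epsilon>"
        using \<epsilon> by force
      then show ?thesis
        using w by cases (simp_all add: integrand_def indicator_def)
    qed
  qed
  moreover have "integral\<^sup>L lebesgue ?l = 2 * trunc F \<sigma> - 2 * Lam * (LINT u:P \<inter> ball 0 \<sigma>|lebesgue. ?w u)"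
    using i\<sigma> iP trunc_symmetrized(2)[OF F \<sigma>]
    by (simp add: set_lebesgue_integral_def trunc_def[symmetric] Bochner_Integration.integrable_add)
  moreover have "integral\<^sup>L lebesgue ?r = 2 * trunc F \<epsilon>"
    using i\<epsilon> trunc_symmetrized(2)[OF F \<epsilon>(1)] by (simp add: trunc_def[symmetric])
  moreover have "Lam * (LINT u:P \<inter> ball 0 \<sigma>|lebesgue. ?w u) \<le> Lam * (inner_const DIM('a) s * ?m * \<sigma> powr (1 - s))"
    using lam by (intro mult_left_mono Pi(2)) auto
  ultimately show ?thesis by (simp add: mult.assoc)
qed

text \<open>The error in the almost monotonicity is of order \<sigma>^(1-s) and tends to 0. The
  limit may be infinite; its existence is what allows \<open>nmc\<close>, a \<open>Lim\<close>, to
  be identified with it.\<close>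

lemma trunc_touching_convergent:
  assumes F: "F \<in> sets lebesgue" and z: "norm z = r" "r > 0" "F \<inter> ball z r = {}"
  obtains l where "((\<lambda>\<epsilon>. ereal (trunc F \<epsilon>)) \<longlongrightarrow> l) (at_right 0)"
proof (rule tendsto_ereal_almost_antimono)
  let ?c = "Lam * inner_const DIM('a) s * (4 ^ DIM('a) * unit_ball_vol (real DIM('a)) / r)"
  have "((\<lambda>\<sigma>. \<sigma> powr (1 - s)) \<longlongrightarrow> 0) (at_right 0)"
  proof (rule tendsto_powr'[of _ 0 _ _ "1 - s", simplified])
  qed (use s in \<open>auto simp: eventually_at_right intro!: exI[of _ 1]\<close>)
  then show "((\<lambda>\<sigma>. ?c * \<sigma> powr (1 - s)) \<longlongrightarrow> 0) (at_right 0)"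
    by (rule tendsto_mult_right_zero)
  show "trunc F \<sigma> - ?c * \<sigma> powr (1 - s) \<le> trunc F \<epsilon>" if "0 < \<epsilon>" "\<epsilon> \<le> \<sigma>" "\<sigma> \<le> r" for \<epsilon> \<sigma>
    by (rule trunc_touching_almost_antimono[OF F z that])
qed (use z that in auto)

end

subsection \<open>Density and curvature\<close>

lemma null_density_reflect:
  fixes x :: "'a::euclidean_space"
  assumes "E \<in> sets lebesgue" "null_density E x"
  shows "null_density {u. x - u \<in> E} 0"
proof -
  have "measure lebesgue (ball (0::'a) t) = measure lebesgue (ball x t)" if "0 < t" for t
    using that by (subst (1 2) measure_lebesgue_ball) auto
  then show ?thesis
    using assms(2) unfolding null_density_def measure_reflect_Int_ball[OF assms(1)] by metis
qed

context elliptic_kernel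
begin

lemma trunc_tendsto_infinity:
  assumes F: "F \<in> sets lebesgue" and null: "null_density F 0"
  shows "((\<lambda>\<epsilon>. ereal (trunc F \<epsilon>)) \<longlongrightarrow> \<infinity>) (at_right 0)"
proof -
  define \<omega> where "\<omega> = unit_ball_vol (real DIM('a))"
  define C where "C = outer_const DIM('a) s"
  define c0 where "c0 = 2 powr (- (real DIM('a)) - s) * \<omega>"
  have pos: "\<omega> > 0" "C > 0" "c0 > 0" "Lam > 0"
    using s lam outer_const_pos[of s] by (auto simp: \<omega>_def C_def c0_def)
  \<comment> \<open>With this choice the density loss consumes exactly half of the gain
    \<open>lam * c0\<close>.\<close>
  define \<kappa> where "\<kappa> = lam * c0 / (4 * Lam * C)"
  have \<kappa>: "\<kappa> > 0" using pos lam by (simp add: \<kappa>_def)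
  obtain \<tau> where \<tau>: "\<tau> > 0" and dens: "\<And>t. 0 < t \<Longrightarrow> t \<le> \<tau> \<Longrightarrow>
      measure lebesgue (F \<inter> ball 0 t) \<le> \<kappa> / \<omega> * measure lebesgue (ball (0::'a) t)"
    using null[unfolded null_density_def, rule_format, OF divide_pos_pos[OF \<kappa> pos(1)]] by blast
  define a where "a = lam * c0 / 2"
  define b where "b = 2 * Lam * C * \<omega> * \<tau> powr (- s)"
  have a: "a > 0" using lam pos by (simp add: a_def)
  have ge: "a * \<epsilon> powr (- s) - b \<le> trunc F \<epsilon>" if \<epsilon>: "0 < \<epsilon>" "\<epsilon> \<le> \<tau>" for \<epsilon>
  proof -
    have "measure lebesgue (F \<inter> ball 0 t) \<le> \<kappa> * t ^ DIM('a)" if "\<epsilon> \<le> t" "t \<le> \<tau>" for t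
    proof -
      have "measure lebesgue (ball (0::'a) t) = \<omega> * t ^ DIM('a)"
        unfolding \<omega>_def using that \<epsilon> by (intro measure_lebesgue_ball) simp
      then show ?thesis using dens[of t] that \<epsilon> pos by simp
    qed
    from trunc_ge_of_small_density[OF F \<epsilon> less_imp_le[OF \<kappa>] this]
    have "(lam * c0 - 2 * Lam * C * \<kappa>) * \<epsilon> powr (- s) - b \<le> trunc F \<epsilon>"
      by (simp add: c0_def \<omega>_def b_def C_def)
    moreover have "lam * c0 - 2 * Lam * C * \<kappa> = a"
      using pos by (simp add: \<kappa>_def a_def field_simps)
    ultimately show ?thesis by simp
  qed
  have "filterlim (trunc F) at_top (at_right 0)"
    unfolding filterlim_at_top
  proof
    fix Z :: real
    \<comment> \<open>Chosen so that \<open>a * X\<close> exceeds \<open>Z + b\<close>; radii up to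
      \<open>X powr (- (1 / s))\<close> satisfy
      \<open>\<epsilon> powr (- s) \<ge> X\<close>.\<close>
    define X where "X = (\<bar>Z\<bar> + \<bar>b\<bar>) / a + 1"
    have X: "X > 0" using a by (simp add: X_def add_nonneg_pos)
    define \<epsilon>0 where "\<epsilon>0 = min \<tau> (X powr (- (1 / s)))"
    show "eventually (\<lambda>\<epsilon>. Z \<le> trunc F \<epsilon>) (at_right 0)"
    proof (rule eventually_at_rightI)
      show "0 < \<epsilon>0" using \<tau> X by (simp add: \<epsilon>0_def)
      fix \<epsilon> assume "\<epsilon> \<in> {0<..<\<epsilon>0}"
      then have \<epsilon>: "0 < \<epsilon>" "\<epsilon> \<le> \<tau>" "\<epsilon> \<le> X powr (- (1 / s))" by (auto simp: \<epsilon>0_def)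
      have "X = (X powr (- (1 / s))) powr (- s)" using s X by (simp add: powr_powr)
      also have "\<dots> \<le> \<epsilon> powr (- s)" using \<epsilon> s by (intro powr_mono2') auto
      finally have "a * X \<le> a * \<epsilon> powr (- s)" using a by simp
      moreover have "a * X = \<bar>Z\<bar> + \<bar>b\<bar> + a" using a by (simp add: X_def field_simps)
      ultimately show "Z \<le> trunc F \<epsilon>" using ge[OF \<epsilon>(1,2)] a by linarith
    qed
  qed
  then show ?thesis by (rule tendsto_PInfty_eq_at_top[THEN iffD2])
qed

lemma eventually_nmc_trunc_eq:
  assumes "E \<in> sets lebesgue"
  shows "eventually (\<lambda>\<epsilon>. ereal (nmc_trunc K E x \<epsilon>) = ereal (trunc {u. x - u \<in> E} \<epsilon>)) (at_right 0)"
  using nmc_trunc_eq_trunc[OF assms] by (intro eventually_at_rightI[of 0 1]) auto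

lemma nmc_trunc_tendsto_infinity:
  assumes E: "E \<in> sets lebesgue" and null: "null_density E x"
  shows "((\<lambda>\<epsilon>. ereal (nmc_trunc K E x \<epsilon>)) \<longlongrightarrow> \<infinity>) (at_right 0)"
  using trunc_tendsto_infinity[OF reflect_measurable[OF E] null_density_reflect[OF E null]]
    tendsto_cong[OF eventually_nmc_trunc_eq[OF E, of x]] by blast

text \<open>Passing to the complement negates \<open>tchi\<close>, and with it every truncated
  integral.\<close>

lemma nmc_trunc_tendsto_minus_infinity:
  assumes E: "E \<in> sets lebesgue" and null: "null_density (- E) x"
  shows "((\<lambda>\<epsilon>. ereal (nmc_trunc K E x \<epsilon>)) \<longlongrightarrow> -\<infinity>) (at_right 0)"
proof -
  have cE: "- E \<in> sets lebesgue" using E by (rule Compl_in_sets_lebesgue[THEN iffD2])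
  have "((\<lambda>\<epsilon>. - ereal (nmc_trunc K (- E) x \<epsilon>)) \<longlongrightarrow> - \<infinity>) (at_right 0)"
    using nmc_trunc_tendsto_infinity[OF cE null] by (rule tendsto_uminus_ereal)
  moreover have "eventually (\<lambda>\<epsilon>. - ereal (nmc_trunc K (- E) x \<epsilon>) = ereal (nmc_trunc K E x \<epsilon>)) (at_right 0)"
  proof (rule eventually_at_rightI[of 0 1])
    fix \<epsilon> :: real assume "\<epsilon> \<in> {0<..<1}"
    moreover have "{u. x - u \<in> - E} = - {u. x - u \<in> E}" by auto
    ultimately show "- ereal (nmc_trunc K (- E) x \<epsilon>) = ereal (nmc_trunc K E x \<epsilon>)"
      using E cE by (simp add: nmc_trunc_eq_trunc trunc_Compl reflect_measurable)
  qed simp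
  ultimately show ?thesis by (rule Lim_transform_eventually)
qed

text \<open>The scales are split at \<open>\<sigma> = \<theta> * r\<close>. Of the gain
  \<open>lam * c0 * \<sigma> powr (- s)\<close>, \<open>const2\<close> lets the thin part of
  \<open>E\<close> above \<sigma> cost one quarter and \<open>const1\<close> lets the touching error
  below \<sigma> cost another. By \<open>const3\<close> the remaining half outweighs both the tail
  beyond R/8 and the viscosity bound.\<close>

lemma nmc_gt_of_thin_exterior_ball:
  assumes E: "E \<in> sets lebesgue" and R: "R > 0"
    and r: "0 < r" "r \<le> R / 16" "dist z x = r" "E \<inter> ball z r = {}"
    and thin: "\<And>t. 0 < t \<Longrightarrow> t \<le> R / 4 \<Longrightarrow>
      measure lebesgue (E \<inter> ball z t) \<le> \<eta> * measure lebesgue (ball z t)"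
    and \<theta>: "0 < \<theta>" "\<theta> \<le> 1" and \<eta>: "0 < \<eta>"
  defines "\<omega> \<equiv> unit_ball_vol (real DIM('a))"
  defines "c0 \<equiv> 2 powr (- (real DIM('a)) - s) * \<omega>"
  assumes const1: "Lam * inner_const DIM('a) s * 4 ^ DIM('a) * \<omega> * \<theta> \<le> lam * c0 / 4"
    and const2: "2 * Lam * outer_const DIM('a) s * (\<eta> * \<omega> * (1 + 1 / \<theta>) ^ DIM('a)) \<le> lam * c0 / 4"
    and const3: "M + 2 * Lam * outer_const DIM('a) s * \<omega> * 8 powr s < lam * c0 / 2 * (16 / \<theta>) powr s"
  shows "ereal (M * R powr (- s)) < nmc K E x"
proof -
  define F where "F = {u. x - u \<in> E}"
  define \<sigma> where "\<sigma> = \<theta> * r"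
  define \<kappa> where "\<kappa> = \<eta> * \<omega> * (1 + 1 / \<theta>) ^ DIM('a)"
  define L where "L = lam * c0 / 2 * \<sigma> powr (- s) - 2 * Lam * outer_const DIM('a) s * \<omega> * (R / 8) powr (- s)"
  have \<omega>: "\<omega> > 0" by (simp add: \<omega>_def)
  have F: "F \<in> sets lebesgue" unfolding F_def by (rule reflect_measurable[OF E])
  have \<sigma>: "0 < \<sigma>" "\<sigma> \<le> r" using r \<theta> by (auto simp: \<sigma>_def mult_left_le_one_le)
  have z': "norm (x - z) = r" "F \<inter> ball (x - z) r = {}"
  proof -
    show "norm (x - z) = r" using r(3) by (simp add: dist_norm norm_minus_commute)
    have "x - u \<in> ball z r" if "u \<in> ball (x - z) r" for u
      using that by (simp add: dist_norm norm_minus_commute algebra_simps)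
    then show "F \<inter> ball (x - z) r = {}" using r(4) by (auto simp: F_def)
  qed
  \<comment> \<open>Thinness is known around \<open>z\<close> only. The ball around \<open>x\<close>
    sits in \<open>ball z (t + r)\<close> with \<open>t + r \<le> R / 4\<close>, and
    \<open>r \<le> t / \<theta>\<close> turns \<open>t + r\<close> into a multiple of
    \<open>t\<close>.\<close>
  have dens: "measure lebesgue (F \<inter> ball 0 t) \<le> \<kappa> * t ^ DIM('a)" if t: "\<sigma> \<le> t" "t \<le> R / 8" for t
  proof -
    have t0: "t > 0" using t \<sigma> by simp
    have "ball x t \<subseteq> ball z (t + r)" using r(3) by (simp add: ball_subset_ball_iff dist_commute)
    then have "measure lebesgue (F \<inter> ball 0 t) \<le> measure lebesgue (E \<inter> ball z (t + r))"
      unfolding F_def measure_reflect_Int_ball[OF E] using E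
      by (intro measure_mono_fmeasurable lmeasurable_Int_ball fmeasurableD[OF lmeasurable_Int_ball]) auto
    also have "\<dots> \<le> \<eta> * measure lebesgue (ball z (t + r))"
      using t t0 r by (intro thin) auto
    also have "\<dots> = \<eta> * \<omega> * (t + r) ^ DIM('a)"
      using t0 r by (subst measure_lebesgue_ball) (auto simp: \<omega>_def)
    also have "\<dots> \<le> \<eta> * \<omega> * ((1 + 1 / \<theta>) * t) ^ DIM('a)"
    proof (intro mult_left_mono power_mono)
      have "r \<le> t / \<theta>" using t(1) \<theta> by (simp add: \<sigma>_def field_simps)
      then show "t + r \<le> (1 + 1 / \<theta>) * t" by (simp add: algebra_simps)
    qed (use t0 r \<eta> \<omega> in auto)
    finally show ?thesis by (simp add: \<kappa>_def power_mult_distrib mult_ac)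
  qed
  have L_le: "L \<le> trunc F \<epsilon>" if \<epsilon>: "0 < \<epsilon>" "\<epsilon> \<le> \<sigma>" for \<epsilon>
  proof -
    have "\<kappa> \<ge> 0" using \<eta> \<omega> \<theta> by (simp add: \<kappa>_def)
    have "(lam * c0 - 2 * Lam * outer_const DIM('a) s * \<kappa>) * \<sigma> powr (- s)
        - 2 * Lam * outer_const DIM('a) s * \<omega> * (R / 8) powr (- s) \<le> trunc F \<sigma>"
      unfolding c0_def \<omega>_def using \<sigma> r R
      by (intro trunc_ge_of_small_density[OF F \<sigma>(1) _ \<open>\<kappa> \<ge> 0\<close>] dens) auto
    moreover have "lam * c0 * (3 / 4) * \<sigma> powr (- s) \<le> (lam * c0 - 2 * Lam * outer_const DIM('a) s * \<kappa>) * \<sigma> powr (- s)"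
    proof (rule mult_right_mono)
      show "lam * c0 * (3 / 4) \<le> lam * c0 - 2 * Lam * outer_const DIM('a) s * \<kappa>"
        using const2 unfolding \<kappa>_def by linarith
    qed simp
    moreover have "trunc F \<sigma> - lam * c0 / 4 * \<sigma> powr (- s) \<le> trunc F \<epsilon>"
    proof -
      have "trunc F \<sigma> - Lam * inner_const DIM('a) s * (4 ^ DIM('a) * \<omega> / r) * \<sigma> powr (1 - s) \<le> trunc F \<epsilon>"
        unfolding \<omega>_def by (rule trunc_touching_almost_antimono[OF F z'(1) r(1) z'(2) \<epsilon> \<sigma>(2)])
      \<comment> \<open>Since \<open>\<sigma> = \<theta> * r\<close>, dividing
        \<open>\<sigma> powr (1 - s)\<close> by \<open>r\<close> leaves
        \<open>\<theta> * \<sigma> powr (- s)\<close>: the touching error is small relative to the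
        gain when \<theta> is small.\<close>
      moreover have "Lam * inner_const DIM('a) s * (4 ^ DIM('a) * \<omega> / r) * \<sigma> powr (1 - s)
          = Lam * inner_const DIM('a) s * 4 ^ DIM('a) * \<omega> * \<theta> * \<sigma> powr (- s)"
      proof -
        have "\<sigma> powr (1 - s) = \<theta> * r * \<sigma> powr (- s)"
          using \<sigma> powr_add[of \<sigma> 1 "- s"] by (simp add: \<sigma>_def)
        then show ?thesis using r(1) by simp
      qed
      moreover have "Lam * inner_const DIM('a) s * 4 ^ DIM('a) * \<omega> * \<theta> * \<sigma> powr (- s) \<le> lam * c0 / 4 * \<sigma> powr (- s)"
        using const1 by (intro mult_right_mono) auto
      ultimately show ?thesis by linarith
    qed
    ultimately show ?thesis unfolding L_def by (simp add: algebra_simps)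
  qed
  \<comment> \<open>As \<sigma> is at most \<theta>R/16, every term compares with a multiple of
    \<open>R powr (- s)\<close>, so the inequality reduces to \<open>const3\<close>, which does not
    involve \<open>R\<close>.\<close>
  have M_less: "M * R powr (- s) < L"
  proof -
    have R8: "(R / 8) powr (- s) = 8 powr s * R powr (- s)"
      using R by (simp add: powr_divide powr_minus divide_simps)
    have "(16 / \<theta>) powr s * R powr (- s) = (\<theta> * (R / 16)) powr (- s)"
      using R \<theta> by (simp add: powr_divide powr_mult powr_minus divide_simps)
    also have "\<dots> \<le> \<sigma> powr (- s)"
      unfolding \<sigma>_def using r \<theta> R s by (intro powr_mono2') auto
    finally have "lam * c0 / 2 * ((16 / \<theta>) powr s * R powr (- s)) \<le> lam * c0 / 2 * \<sigma> powr (- s)"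
      using lam \<omega> by (intro mult_left_mono) (auto simp: c0_def)
    moreover have "(M + 2 * Lam * outer_const DIM('a) s * \<omega> * 8 powr s) * R powr (- s)
        < (lam * c0 / 2 * (16 / \<theta>) powr s) * R powr (- s)"
      using const3 R by (intro mult_strict_right_mono) auto
    ultimately show ?thesis unfolding L_def R8 by (simp add: algebra_simps)
  qed
  obtain l where l: "((\<lambda>\<epsilon>. ereal (trunc F \<epsilon>)) \<longlongrightarrow> l) (at_right 0)"
    by (rule trunc_touching_convergent[OF F z'(1) r(1) z'(2)])
  then have "((\<lambda>\<epsilon>. ereal (nmc_trunc K E x \<epsilon>)) \<longlongrightarrow> l) (at_right 0)"
    using tendsto_cong[OF eventually_nmc_trunc_eq[OF E, of x]] unfolding F_def by blast
  then have "nmc K E x = l"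
    unfolding nmc_def by (intro tendsto_Lim) auto
  moreover have "ereal L \<le> l"
  proof (rule tendsto_lowerbound[OF l])
    show "eventually (\<lambda>\<epsilon>. ereal L \<le> ereal (trunc F \<epsilon>)) (at_right 0)"
      using L_le \<sigma> by (intro eventually_at_rightI[of 0 \<sigma>]) auto
  qed simp
  ultimately show ?thesis using M_less by (metis ereal_less_eq(3) less_le_trans less_ereal.simps(1))
qed

end

section \<open>Choice of constants and the contradiction argument\<close>

lemma thin_constants:
  fixes a b c e s :: real and n :: nat
  assumes "0 < s" "0 < a" "0 < b" "0 < c" "0 \<le> e"
  obtains \<theta> \<eta> where "0 < \<theta>" "\<theta> \<le> 1" "0 < \<eta>" "\<eta> < 1 / 2" "b * \<theta> \<le> a / 4"
    "c * (\<eta> * (1 + 1 / \<theta>) ^ n) \<le> a / 4" "e < a / 2 * (16 / \<theta>) powr s"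
proof -
  \<comment> \<open>\<open>a / 2 * X\<close> equals \<open>e + a / 2\<close>, and the last cap on
    \<theta> below gives \<open>X \<le> (16 / \<theta>) powr s\<close>.\<close>
  define X where "X = 2 * e / a + 1"
  have X: "X > 0" using assms by (simp add: X_def add_nonneg_pos)
  define \<theta> where "\<theta> = min 1 (min (a / (4 * b)) (16 / X powr (1 / s)))"
  have \<theta>: "0 < \<theta>" "\<theta> \<le> 1" "\<theta> \<le> a / (4 * b)" "\<theta> \<le> 16 / X powr (1 / s)"
    using assms X by (auto simp: \<theta>_def)
  define q where "q = (1 + 1 / \<theta>) ^ n"
  have q: "q > 0" using \<theta> by (simp add: q_def add_pos_pos)
  \<comment> \<open>\<eta> is fixed after \<theta>, because the density loss carries the factor
    \<open>q\<close>, which depends on \<theta>.\<close>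
  define \<eta> where "\<eta> = min (1 / 4) (a / (4 * c * q))"
  have \<eta>: "0 < \<eta>" "\<eta> < 1 / 2" "\<eta> \<le> a / (4 * c * q)"
    using assms q by (auto simp: \<eta>_def)
  show thesis
  proof
    show "b * \<theta> \<le> a / 4" using \<theta>(3) assms by (simp add: field_simps)
    show "c * (\<eta> * (1 + 1 / \<theta>) ^ n) \<le> a / 4"
      using \<eta>(3) assms q unfolding q_def[symmetric] by (simp add: field_simps)
    have "X = (X powr (1 / s)) powr s" using assms X by (simp add: powr_powr)
    also have "\<dots> \<le> (16 / \<theta>) powr s"
      using \<theta> X assms by (intro powr_mono2) (auto simp: field_simps)
    finally have "a / 2 * X \<le> a / 2 * (16 / \<theta>) powr s" using assms by simp
    moreover have "a / 2 * X = e + a / 2" using assms by (simp add: X_def field_simps)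
    ultimately show "e < a / 2 * (16 / \<theta>) powr s" using assms by linarith
  qed (use \<theta> \<eta> in auto)
qed

theorem theorem1p6:
  fixes s lam Lam M :: real
  assumes "0 < s" "s < 1" "0 < lam" "lam \<le> Lam" "0 \<le> M"
  shows "\<exists>\<delta>>0. \<forall>(R::real) (K::'a::euclidean_space \<Rightarrow> real) (E::'a set).
     R > 0 \<longrightarrow>
     K \<in> borel_measurable lebesgue \<longrightarrow>
     (\<forall>y. y \<noteq> 0 \<longrightarrow> lam * norm y powr (-(real DIM('a)) - s) \<le> K y
                   \<and> K y \<le> Lam * norm y powr (-(real DIM('a)) - s)
                   \<and> K y = K (- y)) \<longrightarrow>
     E \<in> sets borel \<longrightarrow>
     0 \<in> frontier E \<longrightarrow>
     nmc_le_visc K E (ball 0 (R / 2)) (M * R powr (- s)) \<longrightarrow>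
     measure lebesgue (E \<inter> ball 0 R) < \<delta> * measure lebesgue (ball (0::'a) R) \<longrightarrow>
     (let S = {x \<in> frontier E \<inter> ball 0 (R / 4).
                 ((\<lambda>e. ereal (nmc_trunc K E x e)) \<longlongrightarrow> \<infinity>) (at_right 0)}
      in S \<in> sets lebesgue \<and> emeasure lebesgue S > 0)"
proof -
  define \<omega> where "\<omega> = unit_ball_vol (real DIM('a))"
  define c0 where "c0 = 2 powr (- (real DIM('a)) - s) * \<omega>"
  have \<omega>: "\<omega> > 0" by (simp add: \<omega>_def)
  have Lam: "Lam > 0" using assms by simp
  note pos = outer_const_pos[OF \<open>0 < s\<close>, of "DIM('a)"] inner_const_pos[OF \<open>s < 1\<close>, of "DIM('a)"]
  obtain \<theta> \<eta> where \<theta>: "0 < \<theta>" "\<theta> \<le> 1" and \<eta>: "0 < \<eta>" "\<eta> < 1 / 2"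
    and const1: "Lam * inner_const DIM('a) s * 4 ^ DIM('a) * \<omega> * \<theta> \<le> lam * c0 / 4"
    and const2: "2 * Lam * outer_const DIM('a) s * \<omega> * (\<eta> * (1 + 1 / \<theta>) ^ DIM('a)) \<le> lam * c0 / 4"
    and const3: "M + 2 * Lam * outer_const DIM('a) s * \<omega> * 8 powr s < lam * c0 / 2 * (16 / \<theta>) powr s"
  proof (rule thin_constants)
    show "0 < s" "0 < lam * c0" "0 < Lam * inner_const DIM('a) s * 4 ^ DIM('a) * \<omega>"
      "0 < 2 * Lam * outer_const DIM('a) s * \<omega>" "0 \<le> M + 2 * Lam * outer_const DIM('a) s * \<omega> * 8 powr s"
      using assms \<omega> pos Lam by (auto simp: c0_def)
  qed
  \<comment> \<open>80 = 5 * 16: the 5 is the covering factor of the maximal inequality, and the 16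
    makes the bad set smaller than the ball of radius R/16.\<close>
  define \<delta> where "\<delta> = \<eta> / 80 ^ DIM('a)"
  have "\<delta> > 0" using \<eta> by (simp add: \<delta>_def)
  moreover have "S \<in> sets lebesgue \<and> emeasure lebesgue S > 0"
    if R: "R > 0" and K: "K \<in> borel_measurable lebesgue"
      and K': "\<forall>y. y \<noteq> 0 \<longrightarrow> lam * norm y powr (-(real DIM('a)) - s) \<le> K y
                   \<and> K y \<le> Lam * norm y powr (-(real DIM('a)) - s) \<and> K y = K (- y)"
      and E: "E \<in> sets borel" and E0: "0 \<in> frontier E"
      and visc: "nmc_le_visc K E (ball 0 (R / 2)) (M * R powr (- s))"
      and small: "measure lebesgue (E \<inter> ball 0 R) < \<delta> * measure lebesgue (ball (0::'a) R)"
      and S: "S = {x \<in> frontier E \<inter> ball 0 (R / 4).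
                 ((\<lambda>e. ereal (nmc_trunc K E x e)) \<longlongrightarrow> \<infinity>) (at_right 0)}"
    for R :: real and K :: "'a \<Rightarrow> real" and E S :: "'a set"
  proof -
    have K_bounds: "lam * frac_kernel s y \<le> K y" "K y \<le> Lam * frac_kernel s y" "K (- y) = K y"
      if "y \<noteq> 0" for y
      using K' that unfolding frac_kernel_def by metis+
    interpret elliptic_kernel K s lam Lam
      by unfold_locales (fact assms K K_bounds)+
    have EL: "E \<in> sets lebesgue" using E by auto
    then have cEL: "- E \<in> sets lebesgue" by (rule Compl_in_sets_lebesgue[THEN iffD2])
    define Z where "Z = {x. x \<notin> E \<and> \<not> null_density E x} \<union> {x. x \<notin> - E \<and> \<not> null_density (- E) x}"
    have Z: "negligible Z"
      unfolding Z_def by (intro negligible_Un negligible_not_null_density EL cEL)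
    define N where "N = (closure E - E) \<inter> ball 0 (R / 4)"
    \<comment> \<open>Off \<open>Z\<close>, a point of \<open>E\<close> has limit -\<infinity> and
      so is not in \<open>S\<close>, whereas a point of \<open>N\<close> has null density and limit
      \<infinity>. Thus \<open>S\<close> inherits measurability from \<open>N\<close>, and the two
      are negligible together.\<close>
    have S_iff_N: "x \<in> S \<longleftrightarrow> x \<in> N" if x: "x \<notin> Z" for x
    proof
      assume xS: "x \<in> S"
      have "x \<notin> E"
      proof
        assume "x \<in> E"
        then have "null_density (- E) x" using x by (auto simp: Z_def)
        from nmc_trunc_tendsto_minus_infinity[OF EL this]
        have "(\<infinity>::ereal) = - \<infinity>"
          using xS unfolding S by (intro tendsto_unique[of "at_right (0::real)"]) auto
        then show False by simp
      qed
      then show "x \<in> N" using xS by (auto simp: S N_def frontier_def)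
    next
      assume xN: "x \<in> N"
      then have "null_density E x" using x by (auto simp: N_def Z_def)
      from nmc_trunc_tendsto_infinity[OF EL this] show "x \<in> S"
        using xN interior_subset[of E] by (auto simp: S N_def frontier_def)
    qed
    have NL: "N \<in> sets lebesgue" using E unfolding N_def by auto
    have ZL: "Z \<in> sets lebesgue" "S \<inter> Z \<in> sets lebesgue"
      using Z negligible_subset[OF Z, of "S \<inter> Z"] by (auto intro: negligible_imp_sets)
    have "S = (N - Z) \<union> (S \<inter> Z)" using S_iff_N by auto
    then have SL: "S \<in> sets lebesgue" using NL ZL by (metis sets.Diff sets.Un)
    have "\<not> negligible N"
    proof
      assume negN: "negligible N"
      define U where "U = E \<inter> ball 0 R"
      have U: "U \<in> lmeasurable" unfolding U_def by (rule lmeasurable_Int_ball[OF EL])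
      obtain V where V: "V \<in> lmeasurable" "measure lebesgue V \<le> 5 ^ DIM('a) / \<eta> * measure lebesgue U"
        and V_cov: "{x. \<exists>t. 0 < t \<and> t \<le> R / 4 \<and> \<eta> * measure lebesgue (ball x t) < measure lebesgue (U \<inter> ball x t)} \<subseteq> V"
        by (rule maximal_inequality_ball[OF U \<eta>(1)])
      have "measure lebesgue V < measure lebesgue (ball (0::'a) (R / 16))"
      proof -
        have "5 ^ DIM('a) / \<eta> * measure lebesgue U < 5 ^ DIM('a) / \<eta> * (\<delta> * measure lebesgue (ball (0::'a) R))"
          unfolding U_def using small \<eta> by (intro mult_strict_left_mono) auto
        also have "\<dots> = 5 ^ DIM('a) / 80 ^ DIM('a) * (\<omega> * R ^ DIM('a))"
          using \<eta> R measure_lebesgue_ball[of R "0::'a"] by (simp add: \<delta>_def \<omega>_def)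
        also have "\<dots> = \<omega> * (R / 16) ^ DIM('a)"
          by (simp add: power_divide[symmetric] power_mult_distrib[symmetric] mult.left_commute flip: power_mult_distrib)
        also have "\<dots> = measure lebesgue (ball (0::'a) (R / 16))"
          using R measure_lebesgue_ball[of "R / 16" "0::'a"] by (simp add: \<omega>_def)
        finally show ?thesis using V(2) by simp
      qed
      moreover have "measure lebesgue (ball (0::'a) (R / 16)) \<le> measure lebesgue V"
        if "ball 0 (R / 16) \<subseteq> V \<union> (Z \<union> N)"
      proof -
        have ZN: "negligible (Z \<union> N)" using Z negN by (rule negligible_Un)
        have "measure lebesgue (ball (0::'a) (R / 16)) \<le> measure lebesgue (V \<union> (Z \<union> N))"
          using that V(1) ZN by (intro measure_mono_fmeasurable fmeasurable.Un) (auto intro: negligible_imp_measurable)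
        also have "\<dots> \<le> measure lebesgue V + measure lebesgue (Z \<union> N)"
          using V(1) ZN by (intro measure_Un_le) (auto intro: negligible_imp_sets)
        also have "measure lebesgue (Z \<union> N) = 0" by (rule negligible_imp_measure0[OF ZN])
        finally show ?thesis by simp
      qed
      \<comment> \<open>Otherwise \<open>V\<close> and a null set would cover the ball of radius
        R/16, although \<open>V\<close> has smaller measure.\<close>
      ultimately obtain z where z: "z \<in> ball 0 (R / 16)" "z \<notin> V" "z \<notin> Z" "z \<notin> N" by force
      have thin: "measure lebesgue (E \<inter> ball z t) \<le> \<eta> * measure lebesgue (ball z t)" if t: "0 < t" "t \<le> R / 4" for t
      proof -
        have "norm y < R" if "dist z y < t" for y
          using that t z(1) R norm_triangle_ineq[of z "y - z"] by (simp add: dist_norm norm_minus_commute)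
        then have "U \<inter> ball z t = E \<inter> ball z t" by (auto simp: U_def)
        moreover have "measure lebesgue (U \<inter> ball z t) \<le> \<eta> * measure lebesgue (ball z t)"
        proof (rule ccontr)
          assume "\<not> ?thesis"
          then have "\<eta> * measure lebesgue (ball z t) < measure lebesgue (U \<inter> ball z t)"
            by (simp only: not_le)
          then show False using z(2) V_cov t by blast
        qed
        ultimately show ?thesis by simp
      qed
      \<comment> \<open>Were \<open>z\<close> in \<open>E\<close>, the complement would fill at most
        half of some small ball around \<open>z\<close>, and \<open>E\<close> less than half of it
        since \<eta> < 1/2.\<close>
      have "z \<notin> E"
      proof
        assume "z \<in> E"
        then have "null_density (- E) z" using z(3) by (auto simp: Z_def)
        then obtain \<tau> where \<tau>: "\<tau> > 0" "\<And>t. 0 < t \<and> t \<le> \<tau> \<Longrightarrow>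
            measure lebesgue (- E \<inter> ball z t) \<le> 1 / 2 * measure lebesgue (ball z t)"
          unfolding null_density_def by (meson half_gt_zero zero_less_one)
        define t where "t = min \<tau> (R / 4)"
        have t: "0 < t" "t \<le> \<tau>" "t \<le> R / 4" using \<tau>(1) R by (auto simp: t_def)
        have B: "measure lebesgue (ball z t) > 0" using t by simp
        have "ball z t = (E \<inter> ball z t) \<union> (- E \<inter> ball z t)" by auto
        then have "measure lebesgue (ball z t) \<le> measure lebesgue (E \<inter> ball z t) + measure lebesgue (- E \<inter> ball z t)"
          using measure_Un_le[OF fmeasurableD[OF lmeasurable_Int_ball[OF EL]] fmeasurableD[OF lmeasurable_Int_ball[OF cEL]], of z t z t]
          by simp
        also have "\<dots> \<le> \<eta> * measure lebesgue (ball z t) + 1 / 2 * measure lebesgue (ball z t)"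
          using thin[of t] \<tau>(2)[of t] t by (intro add_mono) auto
        also have "\<dots> < measure lebesgue (ball z t)"
          using mult_strict_right_mono[OF \<eta>(2) B] by simp
        finally show False by simp
      qed
      then have zE: "z \<notin> closure E" using z R by (auto simp: N_def)
      \<comment> \<open>The origin is a competitor for the nearest point, so \<open>r\<close> is at
        most |z| < R/16 and \<open>x\<close> stays within the ball of radius R/2 where the viscosity
        bound applies.\<close>
      have 0: "0 \<in> closure E" using E0 by (simp add: frontier_def)
      then obtain x where x: "x \<in> closure E" "\<And>y. y \<in> closure E \<Longrightarrow> dist z x \<le> dist z y"
        using distance_attains_inf[of "closure E" z] by (metis closed_closure empty_iff)
      define r where "r = dist z x"
      have r: "0 < r" "r \<le> R / 16"
        using zE x(1) x(2)[OF 0] z(1) by (auto simp: r_def)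
      have disj: "ball z r \<inter> closure E = {}" using x(2) by (force simp: r_def)
      have xb: "x \<in> cball z r" by (simp add: r_def)
      have "norm x < R / 2"
        using norm_triangle_ineq[of z "x - z"] z(1) r R by (simp add: r_def dist_norm norm_minus_commute)
      moreover have "x \<in> frontier E"
      proof -
        \<comment> \<open>An open set that misses the ball also misses its closure, which contains
          \<open>x\<close>.\<close>
        have "interior E \<inter> ball z r = {}" using disj interior_subset[of E] closure_subset[of E] by blast
        then have "interior E \<inter> closure (ball z r) = {}" by (simp add: open_Int_closure_eq_empty)
        then show ?thesis using x(1) xb r by (auto simp: frontier_def)
      qed
      moreover have "exterior_touching_ball E x"
        unfolding exterior_touching_ball_def
        using r disj closure_subset[of E] by (intro exI[of _ z] exI[of _ r]) (auto simp: r_def)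
      ultimately have "nmc K E x \<le> ereal (M * R powr (- s))"
        using visc by (auto simp: nmc_le_visc_def)
      moreover have "ereal (M * R powr (- s)) < nmc K E x"
        using const1 const2 const3 closure_subset[of E] disj unfolding c0_def \<omega>_def
        by (intro nmc_gt_of_thin_exterior_ball[OF EL R r _ _ thin \<theta> \<eta>(1)])
          (auto simp: r_def mult_ac)
      ultimately show False by simp
    qed
    moreover have "negligible N" if "negligible S"
      using negligible_Un[OF that Z] by (rule negligible_subset) (use S_iff_N in auto)
    ultimately have "\<not> negligible S" by blast
    then have "emeasure lebesgue S > 0"
      using SL by (metis negligible_iff_null_sets null_setsI not_gr_zero)
    then show ?thesis using SL by blast
  qed
  ultimately show ?thesis
    unfolding Let_def by (intro exI[of _ \<delta>]) blast
qed

end
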